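(* Let $p>3$ be a prime and let $n$ and $k$ be integers coprime to $p$. Then $$\sum_{\chi \bmod p} \sum_{m=1}^{p-1} \left|\sum_{a=1}^{p-1} \chi(ma+n\overline{a})\, e\!\left(\frac{ka}{p}\right)\right|^4=(p-1)\Big(p^2-10p+37+p\,T(p)-T_L(p)\Big),$$ where $$T(p)=\sum_{\substack{1\le u,a,b\le p-1\\ (a-1)^2(u\overline{a}-1)(ub-1)\equiv (b-1)^2(u\overline{b}-1)(ua-1) \pmod p}} \chi_0\big((a-1)^2(u\overline{a}-1)(ub-1)\big)$$ and $$T_L(p)=\sum_{u=1}^{p-1}\left(\sum_{a=1}^{p-1} \left(\frac{(ua-1)(u\overline{a}-1)}{p}\right)\right)^2.$$
   Context: For an integer $a$ coprime to $p$, $\overline{a}$ denotes an integer with $a\overline{a}\equiv 1 \pmod p$ (and $\overline{a}=0$ if $p\mid a$). $e(y)=e^{2\pi i y}$. The sum over $\chi$ runs over all $p-1$ Dirichlet characters modulo $p$; every character takes the value $0$ at multiples of $p$. $\chi_0$ is the principal character mod $p$: $\chi_0(x)=1$ if $p\nmid x$ and $\chi_0(x)=0$ if $p\mid x$. $\left(\frac{\cdot}{p}\right)$ is the Legendre symbol (equal to $0$ at multiples of $p$). *)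

theory Defs
  imports Complex_Main "HOL-Number_Theory.Number_Theory" "HOL-Number_Theory.Modular_Inverse"
begin

definition unit_exp :: "real \<Rightarrow> complex"
  where "unit_exp y = exp (2 * complex_of_real pi * \<i> * complex_of_real y)"

definition dirichlet_characters :: "int \<Rightarrow> (int \<Rightarrow> complex) set"
  where "dirichlet_characters q =
    {\<chi>. (\<forall>a b. \<chi> (a * b) = \<chi> a * \<chi> b) \<and>
        (\<forall>a. \<chi> (a + q) = \<chi> a) \<and>
        (\<forall>a. \<chi> a = 0 \<longleftrightarrow> \<not> coprime a q)}"

definition principal_character :: "int \<Rightarrow> int \<Rightarrow> complex"
  where "principal_character q a = (if coprime a q then 1 else 0)"

lemma principal_character_in_dirichlet_characters:
  "principal_character q \<in> dirichlet_characters q"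
proof -
  have "coprime (a + q) q \<longleftrightarrow> coprime a q" for a :: int
    by (simp add: coprime_iff_gcd_eq_1)
  then show ?thesis
    by (simp add: dirichlet_characters_def principal_character_def)
qed

text \<open>Finiteness ensures that a sum over all characters modulo \<open>q\<close> is not zero by convention.\<close>

lemma finite_dirichlet_characters:
  assumes "q > 0"
  shows "finite (dirichlet_characters q)"
proof -
  define N where "N = totient (nat q)"
  have N: "N > 0"
    using assms by (simp add: N_def)
  have per: "\<chi> (a + of_nat j * q) = \<chi> a"
    if "\<chi> \<in> dirichlet_characters q" for \<chi> a j
  proof (induction j)
    case (Suc j)
    have "\<chi> ((a + of_nat j * q) + q) = \<chi> (a + of_nat j * q)"
      using that unfolding dirichlet_characters_def by blast
    then show ?case
      using Suc by (simp add: algebra_simps)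
  qed simp
  have per_mod: "\<chi> (a mod q) = \<chi> a" if "\<chi> \<in> dirichlet_characters q" for \<chi> a
  proof (cases "a div q \<ge> 0")
    case True
    then show ?thesis
      using per[OF that, of "a mod q" "nat (a div q)"] by (simp add: mult.commute)
  next
    case False
    have "a + (- (a div q)) * q = a mod q"
      by (simp add: minus_div_mult_eq_mod)
    then show ?thesis
      using per[OF that, of a "nat (- (a div q))"] False by simp
  qed
  have root: "\<chi> a = 0 \<or> \<chi> a ^ N = 1" if \<chi>: "\<chi> \<in> dirichlet_characters q" for \<chi> a
  proof (cases "coprime a q")
    case False
    then show ?thesis using \<chi> by (simp add: dirichlet_characters_def)
  next
    case True
    define b where "b = nat (a mod q)"
    have b: "int b = a mod q"
      using assms by (simp add: b_def)
    have "coprime (int b) (int (nat q))"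
      using True assms by (simp add: b)
    then have "coprime b (nat q)"
      using coprime_int_iff by blast
    then have "[b ^ N = 1] (mod nat q)"
      unfolding N_def by (rule euler_theorem)
    then have "int b ^ N mod q = 1 mod q"
      using assms cong_int_iff[of "b ^ N" 1 "nat q"] by (simp add: cong_def)
    then have "\<chi> (int b ^ N) = \<chi> 1"
      using per_mod[OF \<chi>, of "int b ^ N"] per_mod[OF \<chi>, of 1] by simp
    moreover have "\<chi> 1 = 1"
    proof -
      have "\<chi> (1 * 1) = \<chi> 1 * \<chi> 1"
        using \<chi> unfolding dirichlet_characters_def by blast
      moreover have "\<chi> 1 \<noteq> 0"
        using \<chi> by (simp add: dirichlet_characters_def)
      ultimately show ?thesis by simp
    qed
    moreover have "\<chi> (int b ^ j) = \<chi> (int b) ^ j" for j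
      using \<chi> \<open>\<chi> 1 = 1\<close> by (induction j) (auto simp: dirichlet_characters_def)
    ultimately show ?thesis
      using per_mod[OF \<chi>, of a] b by simp
  qed
  have "inj_on (\<lambda>\<chi>. restrict \<chi> {0..<q}) (dirichlet_characters q)"
  proof (rule inj_onI, rule ext)
    fix \<chi> \<psi> a
    assume \<chi>: "\<chi> \<in> dirichlet_characters q" and \<psi>: "\<psi> \<in> dirichlet_characters q"
      and eq: "restrict \<chi> {0..<q} = restrict \<psi> {0..<q}"
    have "\<chi> (a mod q) = \<psi> (a mod q)"
      using fun_cong[OF eq, of "a mod q"] assms by simp
    then show "\<chi> a = \<psi> a"
      using per_mod[OF \<chi>] per_mod[OF \<psi>] by simp
  qed
  moreover have "(\<lambda>\<chi>. restrict \<chi> {0..<q}) ` dirichlet_characters q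
      \<subseteq> {0..<q} \<rightarrow>\<^sub>E insert 0 {z. z ^ N = 1}"
    by (rule image_subsetI, rule PiE_I) (use root in auto)
  moreover have "finite ({0..<q} \<rightarrow>\<^sub>E insert (0::complex) {z. z ^ N = 1})"
    using N by (intro finite_PiE finite.insertI finite_roots_unity) auto
  ultimately show ?thesis
    by (meson finite_imageD finite_subset)
qed

definition T :: "int \<Rightarrow> complex"
  where "T p =
    (\<Sum>(u, a, b) \<in> {(u, a, b). u \<in> {1..p - 1} \<and> a \<in> {1..p - 1} \<and> b \<in> {1..p - 1} \<and>
        [(a - 1)\<^sup>2 * (u * modular_inverse p a - 1) * (u * b - 1) =
         (b - 1)\<^sup>2 * (u * modular_inverse p b - 1) * (u * a - 1)] (mod p)}.
      principal_character p ((a - 1)\<^sup>2 * (u * modular_inverse p a - 1) * (u * b - 1)))"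

definition T_L :: "int \<Rightarrow> int"
  where "T_L p =
    (\<Sum>u = 1..p - 1. (\<Sum>a = 1..p - 1. Legendre ((u * a - 1) * (u * modular_inverse p a - 1)) p)\<^sup>2)"

end

theory Submission
  imports Defs
begin

text \<open>
  Substituting \<open>m \<mapsto> n m\<close> reduces to \<open>n = 1\<close>; put \<open>f(a) = m a + 1/a\<close>. Then \<open>|S\<^sub>\<chi>|\<^sup>2 = \<Sum>\<^sub>l \<chi>(l) R(l)\<close>, where
  \<open>R(l)\<close> runs over the pairs \<open>(a, a s)\<close> with \<open>f(a) \<equiv> l f(a s) \<noteq> 0\<close>, weighted by \<open>e(k a (1 - s) / p)\<close>, so
  Parseval over the characters turns the fourth moment into \<open>(p - 1) \<Sum>\<^sub>l |R(l)|\<^sup>2\<close>. The condition on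
  \<open>(a, s)\<close> depends on \<open>a\<close> and \<open>m\<close> only through \<open>m a\<^sup>2\<close>; replacing \<open>a, d, m\<close> by \<open>r a, r d, m / r\<^sup>2\<close> in
  \<open>\<Sum>\<^sub>m |R(l)|\<^sup>2\<close> and averaging over \<open>r\<close> replaces the exponential by \<open>p [a (1 - s) \<equiv> d (1 - t)] - 1\<close>.

  The term \<open>-1\<close> counts squares of the number of admissible \<open>(a, s)\<close>. For fixed \<open>s\<close> these are solutions
  of a pure quadratic in \<open>a\<close>, so the number is a constant plus the Legendre symbol of \<open>-m\<close> times the inner sum of \<open>T\<^sub>L\<close>.
  The term \<open>p [\<dots>]\<close> counts solutions of two equations linear in \<open>m a\<^sup>2\<close> and \<open>m d\<^sup>2\<close> whose compatibility
  is the summation condition of \<open>T\<close>; only \<open>s, t \<in> {1, -1}\<close> need a separate count.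
\<close>

subsection \<open>Residues modulo a prime\<close>

lemma unit_exp_add: "unit_exp (x + y) = unit_exp x * unit_exp y"
  by (simp add: unit_exp_def algebra_simps exp_add)

lemma cnj_unit_exp: "cnj (unit_exp x) = unit_exp (- x)"
proof -
  have "unit_exp y = cis (2 * pi * y)" for y
    by (simp add: unit_exp_def cis_conv_exp mult_ac)
  then show ?thesis by (simp add: cis_cnj)
qed

lemma unit_exp_eq_1_iff: "unit_exp x = 1 \<longleftrightarrow> x \<in> \<int>"
proof -
  have *: "unit_exp x = cis (2 * pi * x)"
    by (simp add: unit_exp_def cis_conv_exp mult_ac)
  have "unit_exp x = 1 \<longleftrightarrow> cos (2 * pi * x) = 1"
  proof
    assume c: "cos (2 * pi * x) = 1"
    then have "sin (2 * pi * x) = 0"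
      using sin_cos_squared_add[of "2 * pi * x"] by simp
    with c show "unit_exp x = 1"
      by (simp add: * complex_eq_iff)
  qed (simp add: * complex_eq_iff)
  also have "\<dots> \<longleftrightarrow> x \<in> \<int>"
    by (auto simp: cos_one_2pi_int Ints_def)
  finally show ?thesis .
qed

lemma unit_exp_power: "unit_exp x ^ j = unit_exp (of_nat j * x)"
  by (induction j) (simp_all add: unit_exp_add algebra_simps, simp add: unit_exp_def)

lemma of_int_divide_in_Ints_iff:
  fixes a b :: int
  assumes "b \<noteq> 0"
  shows "(of_int a / of_int b :: real) \<in> \<int> \<longleftrightarrow> b dvd a"
proof
  assume "(of_int a / of_int b :: real) \<in> \<int>"
  then obtain c where "(of_int a / of_int b :: real) = of_int c"
    by (elim Ints_cases)
  then have "(of_int a :: real) = of_int (c * b)"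
    using assms by (simp add: field_simps)
  then have "a = c * b"
    by (simp only: of_int_eq_iff)
  then show "b dvd a" by simp
qed (use assms in \<open>auto elim!: dvdE\<close>)

lemma sum_of_bool_unique:
  fixes g :: "'b \<Rightarrow> 'a::semiring_1"
  assumes "finite A" "x \<in> A" "\<And>y. y \<in> A \<Longrightarrow> P y \<longleftrightarrow> y = x"
  shows "(\<Sum>y\<in>A. of_bool (P y) * g y) = g x"
proof -
  have "(\<Sum>y\<in>A. of_bool (P y) * g y) = (\<Sum>y\<in>A. if y = x then g y else 0)"
    by (intro sum.cong) (use assms(3) in auto)
  also have "\<dots> = g x"
    using assms by simp
  finally show ?thesis .
qed

lemma sum_rotate:
  "(\<Sum>x\<in>A. \<Sum>y\<in>B. \<Sum>z\<in>C. f x y z) = (\<Sum>y\<in>B. \<Sum>z\<in>C. \<Sum>x\<in>A. f x y z)"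
proof -
  have "(\<Sum>x\<in>A. \<Sum>y\<in>B. \<Sum>z\<in>C. f x y z) = (\<Sum>y\<in>B. \<Sum>x\<in>A. \<Sum>z\<in>C. f x y z)"
    by (rule sum.swap)
  also have "\<dots> = (\<Sum>y\<in>B. \<Sum>z\<in>C. \<Sum>x\<in>A. f x y z)"
    by (intro sum.cong[OF refl] sum.swap)
  finally show ?thesis .
qed

section \<open>Nonzero residues modulo p, represented by 1, ..., p - 1\<close>

locale prime_gt_3 =
  fixes p :: int
  assumes prime: "prime p" and p_gt_3: "p > 3"
begin

abbreviation units :: "int set" where "units \<equiv> {1..p - 1}"

abbreviation cong_p :: "int \<Rightarrow> int \<Rightarrow> bool"  (infix \<open>\<simeq>\<close> 50)
  where "a \<simeq> b \<equiv> [a = b] (mod p)"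

text \<open>Periodicity is stated through the reduction \<open>x mod p\<close>, the form needed when
  a map on residue classes is reindexed on the representatives 1, ..., p - 1.\<close>

definition periodic :: "(int \<Rightarrow> 'a) \<Rightarrow> bool"
  where "periodic g \<longleftrightarrow> (\<forall>x. g (x mod p) = g x)"

lemma p_dvd_mult_iff [simp]: "p dvd a * b \<longleftrightarrow> p dvd a \<or> p dvd b"
  by (rule prime_dvd_mult_iff[OF prime])

lemma p_dvd_power_iff [simp]: "p dvd a ^ n \<longleftrightarrow> p dvd a \<and> n > 0"
proof (cases n)
  case 0
  then show ?thesis
    using p_gt_3 by simp
qed (use prime_dvd_power_iff[OF prime, of n a] in simp)

lemma p_not_dvd_1 [simp]: "\<not> p dvd 1"
  using p_gt_3 by simp

lemma abs_p_neq_1 [simp]: "\<bar>p\<bar> \<noteq> 1"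
  using p_gt_3 by simp

lemma p_not_dvd_2 [simp]: "\<not> p dvd 2"
  using p_gt_3 zdvd_imp_le[of p 2] by auto

lemma p_not_dvd_3 [simp]: "\<not> p dvd 3"
  using p_gt_3 zdvd_imp_le[of p 3] by auto

lemma coprime_p_iff: "coprime a p \<longleftrightarrow> \<not> p dvd a"
  using prime by (metis coprime_absorb_right coprime_commute p_not_dvd_1 prime_imp_coprime
      zdvd1_eq prime_ge_0_int abs_of_nonneg)

lemma not_dvd_units: "a \<in> units \<Longrightarrow> \<not> p dvd a"
  by (auto dest: zdvd_imp_le)

lemma mod_in_units: "\<not> p dvd a \<Longrightarrow> a mod p \<in> units"
proof -
  assume "\<not> p dvd a"
  then have "a mod p \<noteq> 0"
    by (simp add: dvd_eq_mod_eq_0)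
  moreover have "0 \<le> a mod p" "a mod p < p"
    using p_gt_3 by simp_all
  ultimately show ?thesis by simp
qed

lemma units_cong_iff: "a \<in> units \<Longrightarrow> b \<in> units \<Longrightarrow> a \<simeq> b \<longleftrightarrow> a = b"
  by (auto simp: cong_def)

lemma cong_iff_dvd: "a \<simeq> b \<longleftrightarrow> p dvd a - b"
  by (rule cong_iff_dvd_diff)

lemma periodic_cong: "periodic g \<Longrightarrow> a \<simeq> b \<Longrightarrow> g a = g b"
  unfolding periodic_def cong_def by metis

lemma cong_mod_p: "x mod p \<simeq> x"
  by (simp add: cong_def)

lemmas cong_mod_intros = cong_mod_p cong_add cong_diff cong_mult cong_pow cong_refl

lemma periodicI: "(\<And>x. g (x mod p) = g x) \<Longrightarrow> periodic g"
  by (simp add: periodic_def)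

lemma cong_p_eqI: "a \<simeq> a' \<Longrightarrow> b \<simeq> b' \<Longrightarrow> a \<simeq> b \<longleftrightarrow> a' \<simeq> b'"
  by (simp add: cong_def)

lemma inverse_in_units: "\<not> p dvd a \<Longrightarrow> modular_inverse p a \<in> units"
  using mult_modular_inverse_int_pos[of p a] modular_inverse_int_less[of p a] p_gt_3
  by (auto simp: coprime_p_iff)

lemma mult_inverse: "\<not> p dvd a \<Longrightarrow> a * modular_inverse p a \<simeq> 1"
  by (rule cong_modular_inverse1) (simp add: coprime_p_iff)

lemma ex_inverse:
  assumes "\<not> p dvd a"
  obtains b where "b \<in> units" "p dvd a * b - 1"
  using inverse_in_units[OF assms] mult_inverse[OF assms] by (auto simp: cong_iff_dvd)

text \<open>Multiplication by a nonzero residue permutes the nonzero residues. The multiplicative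
  changes of variable in later sums rest on this.\<close>

lemma sum_units_scale:
  assumes "\<not> p dvd c" and "periodic g"
  shows "(\<Sum>x\<in>units. g (c * x)) = (\<Sum>x\<in>units. g x)"
proof -
  have eq: "units = {1..<p}" by auto
  have "(\<Sum>x\<in>units. g (c * x)) = (\<Sum>x\<in>units. g (c * x mod p))"
    using assms(2) by (simp add: periodic_def)
  also have "\<dots> = (\<Sum>x\<in>units. g x)"
    unfolding eq
    by (rule sum.reindex_bij_betw[OF bij_betw_int_remainders_mult])
      (use assms(1) in \<open>simp add: coprime_p_iff\<close>)
  finally show ?thesis .
qed

lemma ex1_linear:
  assumes "\<not> p dvd a" "\<not> p dvd b"
  shows "\<exists>x\<in>units. \<forall>y\<in>units. a * y \<simeq> b \<longleftrightarrow> y = x"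
proof -
  obtain i where i: "i \<in> units" "p dvd a * i - 1"
    using ex_inverse[OF assms(1)] .
  define x where "x = (b * i) mod p"
  have x: "x \<in> units"
    unfolding x_def using assms not_dvd_units[OF i(1)] by (intro mod_in_units) simp
  have "a * y \<simeq> b \<longleftrightarrow> y = x" if "y \<in> units" for y
  proof -
    have "a * y \<simeq> b \<longleftrightarrow> p dvd a * y - b" by (rule cong_iff_dvd)
    \<comment> \<open>A device used throughout: adding or subtracting a combination of known
      multiples of p preserves divisibility, and the combination is chosen so that the outcome
      follows from a polynomial identity.\<close>
    also have "\<dots> \<longleftrightarrow> p dvd a * (y - b * i)"
    proof -
      have "a * (y - b * i) = (a * y - b) - b * (a * i - 1)" by (simp add: algebra_simps)
      then show ?thesis
        using i(2) by (simp only: dvd_diff_left_iff dvd_mult)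
    qed
    also have "\<dots> \<longleftrightarrow> y \<simeq> b * i"
      using assms by (simp add: cong_iff_dvd)
    also have "\<dots> \<longleftrightarrow> y \<simeq> x"
      unfolding x_def by (simp add: cong_def)
    also have "\<dots> \<longleftrightarrow> y = x"
      using that x by (rule units_cong_iff)
    finally show ?thesis .
  qed
  with x show ?thesis by blast
qed

text \<open>The indicator of a solvable linear congruence collapses a sum to one term. This
  eliminates variables in the counts of the diagonal term.\<close>

lemma sum_linear:
  assumes "\<not> p dvd a" "\<not> p dvd b"
  obtains x where "x \<in> units" "p dvd a * x - b" "\<And>g. (\<Sum>y\<in>units. of_bool (a * y \<simeq> b) * g y) = (g x :: 'a::semiring_1)"
proof -
  obtain x where x: "x \<in> units" "\<And>y. y \<in> units \<Longrightarrow> a * y \<simeq> b \<longleftrightarrow> y = x"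
    using ex1_linear[OF assms] by blast
  show ?thesis
    by (rule that[of x]) (use x in \<open>auto simp: cong_iff_dvd intro!: sum_of_bool_unique\<close>)
qed

lemma card_units_of_bool: "(\<Sum>x\<in>units. of_bool (x = c)) = (of_bool (c \<in> units) :: int)"
proof -
  have "(\<Sum>x\<in>units. of_bool (x = c)) = (\<Sum>x\<in>units. if x = c then 1 else (0::int))"
    by (intro sum.cong) auto
  then show ?thesis by simp
qed

text \<open>A geometric sum of p-th roots of unity. Over all residues it is p or 0; the residue r =
  0 is absent from \<open>units\<close>, which accounts for the -1.\<close>

lemma sum_additive_character:
  assumes "\<not> p dvd k"
  shows "(\<Sum>r\<in>units. unit_exp (of_int (k * (r * y)) / of_int p)) = of_int (p * of_bool (p dvd y) - 1)"
proof -
  define z where "z = unit_exp (of_int (k * y) / of_int p)"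
  have z_power: "z ^ j = unit_exp (of_int (k * (int j * y)) / of_int p)" for j
    unfolding z_def by (simp add: unit_exp_power mult_ac)
  have z1: "z = 1 \<longleftrightarrow> p dvd y"
    unfolding z_def unit_exp_eq_1_iff using p_gt_3 assms
    by (subst of_int_divide_in_Ints_iff) simp_all
  define N where "N = nat p"
  have N: "p = int N" "N > 0"
    using p_gt_3 by (simp_all add: N_def)
  have zN: "z ^ N = 1"
    unfolding z_power unit_exp_eq_1_iff using p_gt_3
    by (subst of_int_divide_in_Ints_iff) (use N in simp_all)
  have "(\<Sum>r\<in>units. unit_exp (of_int (k * (r * y)) / of_int p)) = (\<Sum>j\<in>{1..<N}. z ^ j)"
  proof (rule sum.reindex_bij_witness[of _ int nat])
    fix r assume r: "r \<in> units"
    then show "int (nat r) = r" "nat r \<in> {1..<N}"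
      unfolding N_def by auto
    show "z ^ nat r = unit_exp (of_int (k * (r * y)) / of_int p)"
      unfolding z_power using r by simp
  qed (use N in auto)
  also have "\<dots> = (\<Sum>j<N. z ^ j) - 1"
  proof -
    have "{..<N} = insert 0 {1..<N}" using N by auto
    then show ?thesis by simp
  qed
  also have "\<dots> = of_int (p * of_bool (p dvd y) - 1)"
  proof (cases "p dvd y")
    case True
    then show ?thesis using z1 N by simp
  next
    case False
    then show ?thesis using z1 zN by (simp add: geometric_sum)
  qed
  finally show ?thesis .
qed

subsection \<open>Orthogonality of Dirichlet characters\<close>

lemma character_mult: "\<chi> \<in> dirichlet_characters p \<Longrightarrow> \<chi> (a * b) = \<chi> a * \<chi> b"
  by (simp add: dirichlet_characters_def)

lemma character_eq_0_iff: "\<chi> \<in> dirichlet_characters p \<Longrightarrow> \<chi> a = 0 \<longleftrightarrow> p dvd a"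
  by (simp add: dirichlet_characters_def coprime_p_iff)

lemma character_1: "\<chi> \<in> dirichlet_characters p \<Longrightarrow> \<chi> 1 = 1"
  using character_mult[of \<chi> 1 1] character_eq_0_iff[of \<chi> 1] by simp

lemma character_periodic:
  assumes "\<chi> \<in> dirichlet_characters p"
  shows "periodic \<chi>"
  unfolding periodic_def
proof
  fix x
  have step: "\<chi> (a + p) = \<chi> a" for a
    using assms by (simp add: dirichlet_characters_def)
  have "\<chi> (a + p * int j) = \<chi> a" for a j
  proof (induction j)
    case (Suc j)
    then show ?case
      using step[of "a + p * int j"] by (simp add: algebra_simps)
  qed simp
  then have nonneg: "\<chi> (a + p * j) = \<chi> a" if "j \<ge> 0" for a j
    using that by (metis nonneg_int_cases)
  show "\<chi> (x mod p) = \<chi> x"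
  proof (cases "x div p \<ge> 0")
    case True
    then show ?thesis
      using nonneg[of "x div p" "x mod p"] by simp
  next
    case False
    \<comment> \<open>The induction only climbs by positive multiples of p, so for a negative
      quotient it starts from \<open>x\<close> and reaches \<open>x mod p\<close>.\<close>
    have "x + p * (- (x div p)) = x mod p"
      by (simp add: minus_mult_div_eq_mod)
    with False show ?thesis
      using nonneg[of "- (x div p)" x] by simp
  qed
qed

lemma character_power: "\<chi> \<in> dirichlet_characters p \<Longrightarrow> \<chi> (a ^ j) = \<chi> a ^ j"
  by (induction j) (simp_all add: character_1 character_mult)

text \<open>By Euler's theorem the value \<chi>(a) is a root of unity.\<close>

lemma norm_character:
  assumes "\<chi> \<in> dirichlet_characters p" "\<not> p dvd a"
  shows "cmod (\<chi> a) = 1"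
proof -
  define P where "P = nat p"
  have P: "p = int P" "P > 1"
    using p_gt_3 by (simp_all add: P_def)
  define b where "b = nat (a mod p)"
  have b: "int b = a mod p"
    using p_gt_3 by (simp add: b_def)
  have "coprime (int b) p"
    using assms(2) by (simp add: coprime_p_iff b dvd_eq_mod_eq_0)
  then have "[b ^ totient P = 1] (mod P)"
    by (intro euler_theorem) (simp add: P(1))
  then have "int b ^ totient P \<simeq> 1"
    using cong_int_iff[of "b ^ totient P" 1 P] by (simp add: P(1))
  then have "\<chi> (int b ^ totient P) = \<chi> 1"
    using character_periodic[OF assms(1)] by (metis periodic_cong)
  then have "\<chi> a ^ totient P = 1"
    using character_periodic[OF assms(1)]
    by (simp add: character_power character_1 assms(1) b periodic_def)
  then have "cmod (\<chi> a) ^ totient P = 1"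
    by (metis norm_one norm_power)
  moreover have "totient P > 0"
    using P by simp
  ultimately show ?thesis
    by (metis norm_ge_zero power_eq_1_iff zero_less_iff_neq_zero abs_of_nonneg real_norm_def)
qed

text \<open>With a primitive root g, put \<chi>(g^i) = \<omega>^i for \<omega> = e(1/(p - 1)). As
  \<omega> has exact order p - 1, only the residue 1 is sent to 1.\<close>

lemma ex_separating_character:
  obtains \<chi> where "\<chi> \<in> dirichlet_characters p" "\<And>x. \<chi> x = 1 \<longleftrightarrow> x \<simeq> 1"
proof -
  define P where "P = nat p"
  have P: "p = int P" "P > 1"
    using p_gt_3 by (simp_all add: P_def)
  have "prime P"
    using prime P by simp
  have tot: "totient P = P - 1"
    by (rule totient_prime) fact
  have "odd P"
    using \<open>prime P\<close> p_gt_3 P by (intro prime_odd_nat) auto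
  have "P \<in> cyclic_moduli"
  proof -
    have "\<exists>q k. P = q ^ k \<and> prime q \<and> odd q \<and> k > 0"
      using \<open>prime P\<close> \<open>odd P\<close> by (intro exI[of _ P] exI[of _ "1 :: nat"]) simp
    then show ?thesis
      unfolding cyclic_moduli_def by blast
  qed
  then obtain g where g: "residue_primroot P g"
    using residue_primroot_iff_in_cyclic_moduli by blast
  then have ord: "coprime P g" "ord P g = P - 1"
    by (auto simp: residue_primroot_def tot)
  note gen = residue_primroot_is_generator[OF P(2) g]
  have "\<exists>i. i < P - 1 \<and> x \<simeq> int (g ^ i)" if "\<not> p dvd x" for x
  proof -
    have "coprime (x mod p) p"
      using that by (simp add: coprime_p_iff dvd_eq_mod_eq_0)
    moreover have "nat (x mod p) \<le> P"
      unfolding P_def using p_gt_3 by (intro nat_mono less_imp_le) simp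
    ultimately have "nat (x mod p) \<in> totatives P"
      using mod_in_units[OF that] P p_gt_3 coprime_int_iff[of "nat (x mod p)" P]
      by (auto simp: totatives_def)
    then have "nat (x mod p) \<in> (\<lambda>i. g ^ i mod P) ` {..<P - 1}"
      using gen unfolding tot by (simp add: bij_betw_def)
    then obtain i where i: "i < P - 1" "g ^ i mod P = nat (x mod p)"
      by auto
    have "int (g ^ i) mod p = int (g ^ i mod P)"
      by (simp only: P(1) zmod_int)
    also have "\<dots> = x mod p"
      using i(2) p_gt_3 by simp
    finally have "int (g ^ i) mod p = x mod p" .
    with i show ?thesis by (auto simp: cong_def)
  qed
  then obtain ind where ind: "\<And>x. \<not> p dvd x \<Longrightarrow> ind x < P - 1"
    "\<And>x. \<not> p dvd x \<Longrightarrow> x \<simeq> int (g ^ ind x)"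
    by metis
  \<comment> \<open>Discrete logarithms matter only modulo P - 1, the order of both g and \<omega>.
    This yields multiplicativity and periodicity of \<chi>.\<close>
  have ind_cong: "[i = j] (mod (P - 1))" if "int (g ^ i) \<simeq> int (g ^ j)" for i j
    using that order_divides_expdiff[OF ord(1), of i j] ord(2)
    unfolding P(1) cong_int_iff by simp
  define \<omega> where "\<omega> = unit_exp (1 / of_nat (P - 1))"
  have \<omega>: "\<omega> ^ j = 1 \<longleftrightarrow> (P - 1) dvd j" for j
  proof -
    have "\<omega> ^ j = 1 \<longleftrightarrow> (of_int (int j) / of_int (int (P - 1)) :: real) \<in> \<int>"
      unfolding \<omega>_def unit_exp_power unit_exp_eq_1_iff by simp
    also have "\<dots> \<longleftrightarrow> int (P - 1) dvd int j"
      using P by (intro of_int_divide_in_Ints_iff) simp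
    finally show ?thesis by simp
  qed
  have \<omega>_cong: "\<omega> ^ i = \<omega> ^ j" if "[i = j] (mod (P - 1))" for i j
  proof -
    have "\<omega> ^ i = \<omega> ^ (i mod (P - 1))" for i
    proof -
      have "\<omega> ^ i = \<omega> ^ ((P - 1) * (i div (P - 1)) + i mod (P - 1))" by simp
      also have "\<dots> = \<omega> ^ (i mod (P - 1))"
        unfolding power_add power_mult using \<omega>[of "P - 1"] by simp
      finally show ?thesis .
    qed
    then show ?thesis
      using that by (metis cong_def)
  qed
  define \<chi> where "\<chi> x = (if p dvd x then 0 else \<omega> ^ ind x)" for x
  have \<omega>0: "\<omega> \<noteq> 0" by (simp add: \<omega>_def unit_exp_def)
  have "\<chi> (a * b) = \<chi> a * \<chi> b" for a b
  proof (cases "p dvd a \<or> p dvd b")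
    case False
    have "int (g ^ ind (a * b)) \<simeq> a * b"
      using ind(2)[of "a * b"] False by (simp add: cong_sym)
    also have "a * b \<simeq> int (g ^ ind a) * int (g ^ ind b)"
      using False by (intro cong_mult ind) auto
    also have "int (g ^ ind a) * int (g ^ ind b) = int (g ^ (ind a + ind b))"
      by (simp add: power_add)
    finally have "\<omega> ^ ind (a * b) = \<omega> ^ (ind a + ind b)"
      by (intro \<omega>_cong ind_cong)
    with False show ?thesis
      by (simp add: \<chi>_def power_add)
  qed (auto simp: \<chi>_def)
  moreover have "\<chi> (a + p) = \<chi> a" for a
  proof (cases "p dvd a")
    case False
    have "int (g ^ ind (a + p)) \<simeq> a + p"
      using ind(2)[of "a + p"] False by (simp add: cong_sym)
    also have "a + p \<simeq> a"
      by (simp add: cong_def)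
    also have "a \<simeq> int (g ^ ind a)"
      by (rule ind) fact
    finally have "\<omega> ^ ind (a + p) = \<omega> ^ ind a"
      by (intro \<omega>_cong ind_cong)
    with False show ?thesis
      by (simp add: \<chi>_def)
  qed (auto simp: \<chi>_def)
  moreover have "\<chi> a = 0 \<longleftrightarrow> \<not> coprime a p" for a
    using \<omega>0 by (simp add: \<chi>_def coprime_p_iff)
  ultimately have \<chi>: "\<chi> \<in> dirichlet_characters p"
    by (simp add: dirichlet_characters_def)
  have "\<chi> x = 1 \<longleftrightarrow> x \<simeq> 1" for x
  proof
    assume x: "\<chi> x = 1"
    then have "\<not> p dvd x" "(P - 1) dvd ind x"
      using \<omega> by (auto simp: \<chi>_def split: if_splits)
    then have "ind x = 0"
      using ind(1)[of x] by (auto dest: dvd_imp_le)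
    then show "x \<simeq> 1"
      using ind(2)[of x] \<open>\<not> p dvd x\<close> by simp
  next
    assume "x \<simeq> 1"
    then show "\<chi> x = 1"
      using \<chi> by (metis character_1 character_periodic periodic_cong)
  qed
  with \<chi> show ?thesis by (rule that)
qed

section \<open>Orthogonality relations and Parseval's identity\<close>

lemma sum_units_character:
  assumes "\<chi> \<in> dirichlet_characters p" "x \<in> units" "\<chi> x \<noteq> 1"
  shows "(\<Sum>a\<in>units. \<chi> a) = 0"
proof -
  have "(\<Sum>a\<in>units. \<chi> (x * a)) = (\<Sum>a\<in>units. \<chi> a)"
    by (intro sum_units_scale character_periodic not_dvd_units assms)
  then have "\<chi> x * (\<Sum>a\<in>units. \<chi> a) = (\<Sum>a\<in>units. \<chi> a)"
    by (simp add: character_mult[OF assms(1)] sum_distrib_left)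
  with assms(3) show ?thesis by simp
qed

lemma mult_character:
  assumes "\<chi> \<in> dirichlet_characters p" "\<psi> \<in> dirichlet_characters p"
  shows "(\<lambda>x. \<chi> x * \<psi> x) \<in> dirichlet_characters p"
  using assms by (simp add: dirichlet_characters_def mult_ac)

lemma cnj_character:
  assumes "\<chi> \<in> dirichlet_characters p"
  shows "(\<lambda>x. cnj (\<chi> x)) \<in> dirichlet_characters p"
  using assms by (simp add: dirichlet_characters_def)

lemma finite_characters: "finite (dirichlet_characters p)"
  using p_gt_3 by (intro finite_dirichlet_characters) simp

text \<open>Multiplication by a character \<psi> with \<psi>(x) \<noteq> 1 permutes the characters,
  with multiplication by its conjugate as inverse, so the sum equals \<psi>(x) times itself.\<close>

lemma sum_characters_eq_0:
  assumes "\<not> x \<simeq> 1"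
  shows "(\<Sum>\<chi>\<in>dirichlet_characters p. \<chi> x) = 0"
proof (cases "p dvd x")
  case True
  then show ?thesis by (intro sum.neutral) (simp add: character_eq_0_iff)
next
  case False
  obtain \<psi> where \<psi>: "\<psi> \<in> dirichlet_characters p" "\<psi> x \<noteq> 1"
    using ex_separating_character assms by metis
  have norm: "\<psi> y * cnj (\<psi> y) = 1 \<or> p dvd y" for y
    using norm_character[OF \<psi>(1), of y] by (auto simp flip: complex_norm_square)
  have cancel: "\<psi> y * (cnj (\<psi> y) * \<chi> y) = \<chi> y" "cnj (\<psi> y) * (\<psi> y * \<chi> y) = \<chi> y"
    if "\<chi> \<in> dirichlet_characters p" for \<chi> y
  proof -
    show "\<psi> y * (cnj (\<psi> y) * \<chi> y) = \<chi> y"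
      using norm[of y] character_eq_0_iff[OF that, of y] by (metis mult.assoc mult_1 mult_zero_right)
    then show "cnj (\<psi> y) * (\<psi> y * \<chi> y) = \<chi> y"
      by (simp add: mult.left_commute)
  qed
  have "(\<Sum>\<chi>\<in>dirichlet_characters p. \<psi> x * \<chi> x) = (\<Sum>\<chi>\<in>dirichlet_characters p. \<chi> x)"
    by (rule sum.reindex_bij_witness[of _ "\<lambda>\<chi> y. cnj (\<psi> y) * \<chi> y" "\<lambda>\<chi> y. \<psi> y * \<chi> y"])
      (use \<psi> in \<open>auto simp: cancel mult_character cnj_character\<close>)
  then have "\<psi> x * (\<Sum>\<chi>\<in>dirichlet_characters p. \<chi> x) = (\<Sum>\<chi>\<in>dirichlet_characters p. \<chi> x)"
    by (simp add: sum_distrib_left)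
  with \<psi> show ?thesis by simp
qed

text \<open>Double counting of the sum of \<chi>(a) over all \<chi> and a. Summed over a first, only
  the principal character survives, with p - 1; summed over \<chi> first, only a = 1 survives, with
  the number of characters.\<close>

lemma card_characters: "int (card (dirichlet_characters p)) = p - 1"
proof -
  have "(\<Sum>\<chi>\<in>dirichlet_characters p. \<Sum>a\<in>units. \<chi> a) = of_int (p - 1)"
  proof -
    have "(\<Sum>a\<in>units. \<chi> a) = (if \<chi> = principal_character p then of_int (p - 1) else 0)"
      if \<chi>: "\<chi> \<in> dirichlet_characters p" for \<chi>
    proof (cases "\<exists>x\<in>units. \<chi> x \<noteq> 1")
      case True
      then have "\<chi> \<noteq> principal_character p"
        by (auto simp: principal_character_def coprime_p_iff not_dvd_units)
      with True show ?thesis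
        using sum_units_character[OF \<chi>] by auto
    next
      case False
      have "\<chi> x = principal_character p x" for x
      proof (cases "p dvd x")
        case True
        then show ?thesis
          by (simp add: principal_character_def coprime_p_iff character_eq_0_iff[OF \<chi>])
      next
        case notdvd: False
        then have "\<chi> (x mod p) = 1"
          using False mod_in_units by blast
        then show ?thesis
          using notdvd character_periodic[OF \<chi>]
          by (simp add: principal_character_def coprime_p_iff periodic_def)
      qed
      with False show ?thesis
        using p_gt_3 by auto
    qed
    then show ?thesis
      using principal_character_in_dirichlet_characters[of p] finite_characters by simp
  qed
  also have "(\<Sum>\<chi>\<in>dirichlet_characters p. \<Sum>a\<in>units. \<chi> a)
      = (\<Sum>a\<in>units. \<Sum>\<chi>\<in>dirichlet_characters p. \<chi> a)"
    by (rule sum.swap)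
  also have "\<dots> = (\<Sum>a\<in>units. if a = 1 then \<Sum>\<chi>\<in>dirichlet_characters p. \<chi> 1 else 0)"
    by (intro sum.cong) (use p_gt_3 in \<open>auto simp: sum_characters_eq_0 units_cong_iff\<close>)
  also have "\<dots> = of_int (int (card (dirichlet_characters p)))"
    using p_gt_3 by (simp add: character_1)
  finally show ?thesis
    by (simp only: of_int_eq_iff)
qed

text \<open>The conjugate of \<chi>(y) is the value of \<chi> at the inverse z of y, so everything
  reduces to the sum of \<chi>(x z).\<close>

lemma sum_characters:
  assumes "x \<in> units" "y \<in> units"
  shows "(\<Sum>\<chi>\<in>dirichlet_characters p. \<chi> x * cnj (\<chi> y)) = (if x = y then of_int (p - 1) else 0)"
proof -
  obtain z where z: "z \<in> units" "p dvd y * z - 1"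
    using ex_inverse[OF not_dvd_units[OF assms(2)]] .
  have *: "\<chi> x * cnj (\<chi> y) = \<chi> (x * z)" if \<chi>: "\<chi> \<in> dirichlet_characters p" for \<chi>
  proof -
    have "\<chi> y * \<chi> z = 1"
      using z(2) character_1[OF \<chi>] character_mult[OF \<chi>, of y z]
        periodic_cong[OF character_periodic[OF \<chi>], of "y * z" 1]
      by (simp add: cong_iff_dvd)
    moreover have "\<chi> y * cnj (\<chi> y) = 1"
      using norm_character[OF \<chi> not_dvd_units[OF assms(2)]] by (simp flip: complex_norm_square)
    ultimately have "cnj (\<chi> y) = \<chi> z"
      by (metis mult_cancel_left zero_neq_one mult_zero_left)
    then show ?thesis
      by (simp add: character_mult[OF \<chi>])
  qed
  have "x * z \<simeq> 1 \<longleftrightarrow> x = y"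
  proof -
    have "x * z \<simeq> 1 \<longleftrightarrow> p dvd (x * z - 1) - (y * z - 1)"
      by (simp only: cong_iff_dvd dvd_diff_left_iff[OF z(2)])
    also have "(x * z - 1) - (y * z - 1) = (x - y) * z"
      by (simp add: algebra_simps)
    also have "p dvd \<dots> \<longleftrightarrow> x = y"
      using not_dvd_units[OF z(1)] assms units_cong_iff[of x y] by (simp add: cong_iff_dvd)
    finally show ?thesis .
  qed
  note iff = this
  have "(\<Sum>\<chi>\<in>dirichlet_characters p. \<chi> x * cnj (\<chi> y)) = (\<Sum>\<chi>\<in>dirichlet_characters p. \<chi> (x * z))"
    by (intro sum.cong refl *)
  also have "\<dots> = (if x = y then of_int (p - 1) else 0)"
  proof (cases "x = y")
    case True
    then have "x * z \<simeq> 1" by (rule iffD2[OF iff])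
    then have "\<chi> (x * z) = 1" if "\<chi> \<in> dirichlet_characters p" for \<chi>
      using periodic_cong[OF character_periodic[OF that]] character_1[OF that] by metis
    then have "(\<Sum>\<chi>\<in>dirichlet_characters p. \<chi> (x * z)) = (\<Sum>\<chi>\<in>dirichlet_characters p. 1)"
      by (rule sum.cong[OF refl])
    also have "\<dots> = of_nat (card (dirichlet_characters p))"
      by simp
    also have "\<dots> = of_int (p - 1)"
      by (metis card_characters of_int_of_nat_eq)
    finally show ?thesis
      using True by simp
  next
    case False
    then show ?thesis
      using sum_characters_eq_0[of "x * z"] iff by simp
  qed
  finally show ?thesis .
qed

lemma parseval_characters:
  fixes R :: "int \<Rightarrow> complex"
  shows "(\<Sum>\<chi>\<in>dirichlet_characters p. (cmod (\<Sum>x\<in>units. \<chi> x * R x))\<^sup>2)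
    = of_int (p - 1) * (\<Sum>x\<in>units. (cmod (R x))\<^sup>2)"
proof -
  have "complex_of_real (\<Sum>\<chi>\<in>dirichlet_characters p. (cmod (\<Sum>x\<in>units. \<chi> x * R x))\<^sup>2)
    = (\<Sum>\<chi>\<in>dirichlet_characters p. \<Sum>x\<in>units. \<Sum>y\<in>units. R x * cnj (R y) * (\<chi> x * cnj (\<chi> y)))"
    unfolding of_real_sum complex_norm_square cnj_sum sum_product complex_cnj_mult
    by (simp add: mult_ac)
  also have "\<dots> = (\<Sum>x\<in>units. \<Sum>y\<in>units. \<Sum>\<chi>\<in>dirichlet_characters p. R x * cnj (R y) * (\<chi> x * cnj (\<chi> y)))"
    by (rule sum_rotate)
  also have "\<dots> = (\<Sum>x\<in>units. \<Sum>y\<in>units. if y = x then R x * cnj (R x) * of_int (p - 1) else 0)"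
    by (intro sum.cong refl) (auto simp: sum_characters simp flip: sum_distrib_left)
  also have "\<dots> = complex_of_real (of_int (p - 1) * (\<Sum>x\<in>units. (cmod (R x))\<^sup>2))"
    unfolding of_real_mult of_real_sum complex_norm_square by (simp add: sum_distrib_left mult_ac)
  finally show ?thesis
    by (simp only: of_real_eq_iff)
qed

subsection \<open>Reduction to counting\<close>

lemma periodic_inverse: "periodic (modular_inverse p)"
  unfolding periodic_def
proof
  fix x
  show "modular_inverse p (x mod p) = modular_inverse p x"
  proof (cases "p dvd x")
    case True
    \<comment> \<open>At multiples of p both sides take the default value 0 of
      \<open>modular_inverse\<close>.\<close>
    then have "\<not> coprime x p" "\<not> coprime (x mod p) p"
      by (simp_all add: coprime_p_iff dvd_eq_mod_eq_0)
    then show ?thesis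
      by (simp only: mult_modular_inverse_of_not_coprime simp_thms)
  next
    case False
    have "x mod p * modular_inverse p x \<simeq> 1"
      using mult_inverse[OF False] by (simp add: cong_def mod_simps)
    then show ?thesis
      using inverse_in_units[OF False] by (intro modular_inverse_int_eqI) auto
  qed
qed

section \<open>The squared modulus as a combination of character values\<close>

definition additive_char :: "int \<Rightarrow> int \<Rightarrow> complex"
  where "additive_char k y = unit_exp (of_int (k * y) / of_int p)"

lemma additive_char_add: "additive_char k (x + y) = additive_char k x * additive_char k y"
  by (simp add: additive_char_def algebra_simps add_divide_distrib flip: unit_exp_add)

lemma cnj_additive_char: "cnj (additive_char k x) = additive_char k (- x)"
  by (simp add: additive_char_def cnj_unit_exp)

lemma additive_char_diff: "additive_char k (x - y) = additive_char k x * cnj (additive_char k y)"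
  using additive_char_add[of k x "- y"] by (simp add: cnj_additive_char)

lemma periodic_additive_char: "periodic (additive_char k)"
  unfolding periodic_def
proof
  fix x
  have "additive_char k (p * (x div p)) = 1"
    unfolding additive_char_def unit_exp_eq_1_iff
    by (subst of_int_divide_in_Ints_iff) (use p_gt_3 in simp_all)
  then have "additive_char k (p * (x div p) + x mod p) = additive_char k (x mod p)"
    unfolding additive_char_add by simp
  then show "additive_char k (x mod p) = additive_char k x" by simp
qed

text \<open>
  For \<open>x = m a\<^sup>2\<close> and \<open>f(a) = m a + 1/a\<close> this says \<open>f(a) \<equiv> l f(a s)\<close> and \<open>f(a) \<noteq> 0\<close>, multiplied by \<open>a s\<close>.
\<close>
definition admissible :: "int \<Rightarrow> int \<Rightarrow> int \<Rightarrow> bool"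
  where "admissible l s x \<longleftrightarrow> \<not> p dvd x + 1 \<and> x * s * (1 - l * s) \<simeq> l - s"

text \<open>For nonzero x and y the quotient x/y is the only l with x = l y, and conjugation inverts
  \<chi>(y). If one of them is zero, the left side vanishes and no l satisfies the condition on the
  right.\<close>

lemma character_quotient:
  assumes \<chi>: "\<chi> \<in> dirichlet_characters p"
  shows "\<chi> x * cnj (\<chi> y) = (\<Sum>l\<in>units. \<chi> l * of_bool (\<not> p dvd x \<and> x \<simeq> l * y))"
proof (cases "p dvd x \<or> p dvd y")
  case True
  then have "\<chi> x * cnj (\<chi> y) = 0"
    using \<chi> by (auto simp: character_eq_0_iff)
  moreover have "\<chi> l * of_bool (\<not> p dvd x \<and> x \<simeq> l * y) = 0" for l
    using True cong_dvd_iff[of x "l * y" p] by auto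
  ultimately show ?thesis
    by (simp only: sum.neutral_const)
next
  case False
  obtain l where l: "l \<in> units" "p dvd y * l - x"
    "\<And>g. (\<Sum>z\<in>units. of_bool (y * z \<simeq> x) * g z) = (g l :: complex)"
    using sum_linear[of y x] False by blast
  have "\<chi> x * cnj (\<chi> y) = \<chi> (y * l) * cnj (\<chi> y)"
    using periodic_cong[OF character_periodic[OF \<chi>], of "y * l" x] l(2)
    by (simp add: cong_iff_dvd)
  also have "\<dots> = \<chi> l * (\<chi> y * cnj (\<chi> y))"
    by (simp add: character_mult[OF \<chi>])
  also have "\<dots> = \<chi> l"
    using norm_character[OF \<chi>, of y] False by (simp flip: complex_norm_square)
  also have "\<dots> = (\<Sum>z\<in>units. of_bool (y * z \<simeq> x) * \<chi> z)"
    using l(3) by simp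
  also have "\<dots> = (\<Sum>z\<in>units. \<chi> z * of_bool (\<not> p dvd x \<and> x \<simeq> z * y))"
    using False by (intro sum.cong refl) (auto simp: mult.commute cong_sym_eq)
  finally show ?thesis .
qed

text \<open>The nonvanishing condition is multiplied by \<open>a\<close> and the congruence by
  \<open>a * s\<close>, both invertible; the inverses i and j then disappear through a i = 1 and a s
  j = 1.\<close>

lemma admissible_iff:
  assumes "a \<in> units" "s \<in> units"
  shows "admissible l s (m * a\<^sup>2) \<longleftrightarrow>
    \<not> p dvd m * a + modular_inverse p a \<and>
    m * a + modular_inverse p a \<simeq> l * (m * (a * s) + modular_inverse p (a * s))"
proof -
  define i j where "i = modular_inverse p a" and "j = modular_inverse p (a * s)"
  have nd: "\<not> p dvd a" "\<not> p dvd s"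
    using assms by (simp_all add: not_dvd_units)
  have i: "p dvd a * i - 1" and j: "p dvd a * s * j - 1"
    using mult_inverse[of a] mult_inverse[of "a * s"] nd
    by (simp_all add: i_def j_def cong_iff_dvd)
  have "p dvd m * a + i \<longleftrightarrow> p dvd a * (m * a + i) - (a * i - 1)"
    using nd by (simp only: dvd_diff_left_iff[OF i] p_dvd_mult_iff simp_thms)
  also have "a * (m * a + i) - (a * i - 1) = m * a\<^sup>2 + 1"
    by (simp add: algebra_simps power2_eq_square)
  finally have 1: "p dvd m * a + i \<longleftrightarrow> p dvd m * a\<^sup>2 + 1" .
  have ij: "p dvd s * (a * i - 1) - l * (a * s * j - 1)"
    using i j by (simp only: dvd_diff dvd_mult)
  have "m * a + i \<simeq> l * (m * (a * s) + j) \<longleftrightarrow>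
      p dvd a * s * (m * a + i - l * (m * (a * s) + j)) - (s * (a * i - 1) - l * (a * s * j - 1))"
    using nd by (simp only: dvd_diff_left_iff[OF ij] p_dvd_mult_iff simp_thms cong_iff_dvd)
  also have "a * s * (m * a + i - l * (m * (a * s) + j)) - (s * (a * i - 1) - l * (a * s * j - 1))
      = m * a\<^sup>2 * s * (1 - l * s) - (l - s)"
    by (simp add: algebra_simps power2_eq_square)
  finally show ?thesis
    unfolding admissible_def using 1 by (simp add: cong_iff_dvd i_def j_def)
qed

text \<open>The square is expanded over pairs (a, c), c is replaced by a s, and the products of
  character values are sorted by the quotient l of their arguments.\<close>

lemma norm_square_character_sum:
  assumes \<chi>: "\<chi> \<in> dirichlet_characters p"
  shows "complex_of_real ((cmod (\<Sum>a\<in>units. \<chi> (m * a + modular_inverse p a) * additive_char k a))\<^sup>2)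
    = (\<Sum>l\<in>units. \<chi> l *
        (\<Sum>a\<in>units. \<Sum>s\<in>units. of_bool (admissible l s (m * a\<^sup>2)) * additive_char k (a * (1 - s))))"
proof -
  define f where "f a = m * a + modular_inverse p a" for a
  have f_mod: "\<chi> (f (x mod p)) = \<chi> (f x)" for x
  proof (rule periodic_cong[OF character_periodic[OF \<chi>]])
    have "modular_inverse p (x mod p) = modular_inverse p x"
      using periodic_inverse by (simp add: periodic_def)
    then show "f (x mod p) \<simeq> f x"
      by (simp only: f_def) (intro cong_mod_intros)
  qed
  have "complex_of_real ((cmod (\<Sum>a\<in>units. \<chi> (f a) * additive_char k a))\<^sup>2)
    = (\<Sum>a\<in>units. \<Sum>c\<in>units. \<chi> (f a) * cnj (\<chi> (f c)) * additive_char k (a - c))"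
    unfolding complex_norm_square cnj_sum sum_product complex_cnj_mult additive_char_diff
    by (simp add: mult_ac)
  also have "\<dots> = (\<Sum>a\<in>units. \<Sum>s\<in>units. \<chi> (f a) * cnj (\<chi> (f (a * s))) * additive_char k (a - a * s))"
  proof (rule sum.cong[OF refl])
    fix a assume "a \<in> units"
    have "periodic (\<lambda>c. \<chi> (f a) * cnj (\<chi> (f c)) * additive_char k (a - c))"
      unfolding periodic_def additive_char_diff
      using f_mod periodic_additive_char[of k] by (simp add: periodic_def)
    from sum_units_scale[OF not_dvd_units[OF \<open>a \<in> units\<close>] this]
    show "(\<Sum>c\<in>units. \<chi> (f a) * cnj (\<chi> (f c)) * additive_char k (a - c)) =
      (\<Sum>s\<in>units. \<chi> (f a) * cnj (\<chi> (f (a * s))) * additive_char k (a - a * s))" ..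
  qed
  also have "\<dots> = (\<Sum>a\<in>units. \<Sum>s\<in>units. \<Sum>l\<in>units.
      \<chi> l * (of_bool (admissible l s (m * a\<^sup>2)) * additive_char k (a * (1 - s))))"
  proof (intro sum.cong refl)
    fix a s assume as: "a \<in> units" "s \<in> units"
    have "\<chi> (f a) * cnj (\<chi> (f (a * s))) = (\<Sum>l\<in>units. \<chi> l * of_bool (admissible l s (m * a\<^sup>2)))"
      unfolding character_quotient[OF \<chi>] admissible_iff[OF as] f_def ..
    then show "\<chi> (f a) * cnj (\<chi> (f (a * s))) * additive_char k (a - a * s) = (\<Sum>l\<in>units.
      \<chi> l * (of_bool (admissible l s (m * a\<^sup>2)) * additive_char k (a * (1 - s))))"
      by (simp only: sum_distrib_left right_diff_distrib mult_ac mult_1_right mult_1_left)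
  qed
  also have "\<dots> = (\<Sum>l\<in>units. \<Sum>a\<in>units. \<Sum>s\<in>units.
      \<chi> l * (of_bool (admissible l s (m * a\<^sup>2)) * additive_char k (a * (1 - s))))"
    by (rule sum_rotate[symmetric])
  finally show ?thesis
    unfolding f_def by (simp only: sum_distrib_left)
qed

text \<open>The squared modulus is itself a linear combination of the \<chi>(l) with coefficients
  independent of \<chi>, so its square is subject to Parseval's identity.\<close>

lemma sum_fourth_power:
  "(\<Sum>\<chi>\<in>dirichlet_characters p.
      (cmod (\<Sum>a\<in>units. \<chi> (m * a + modular_inverse p a) * additive_char k a)) ^ 4)
    = of_int (p - 1) * (\<Sum>l\<in>units. (cmod
        (\<Sum>a\<in>units. \<Sum>s\<in>units. of_bool (admissible l s (m * a\<^sup>2)) * additive_char k (a * (1 - s))))\<^sup>2)"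
proof -
  have "(cmod (\<Sum>a\<in>units. \<chi> (m * a + modular_inverse p a) * additive_char k a)) ^ 4
    = (cmod (\<Sum>l\<in>units. \<chi> l *
        (\<Sum>a\<in>units. \<Sum>s\<in>units. of_bool (admissible l s (m * a\<^sup>2)) * additive_char k (a * (1 - s)))))\<^sup>2"
    if "\<chi> \<in> dirichlet_characters p" for \<chi>
    unfolding norm_square_character_sum[OF that, symmetric] norm_of_real power2_abs
    by simp
  then show ?thesis
    by (simp add: parseval_characters)
qed

section \<open>Averaging over rescalings of the variables\<close>

lemma periodic_admissible: "periodic (admissible l s)"
  unfolding admissible_def
  by (intro periodicI arg_cong2[of _ _ _ _ "(\<and>)"] arg_cong[of _ _ Not] cong_p_eqI cong_dvd_iff cong_mod_intros)

text \<open>Scaling a and d by r multiplies the argument of \<open>h\<close> by r and the arguments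
  of \<open>P\<close> and \<open>Q\<close> by r^2; the factor r^2 is then absorbed by the sum over
  m.\<close>

lemma sum_units3_rescale:
  fixes h :: "int \<Rightarrow> 'a::comm_semiring_1"
  assumes "periodic P" "periodic Q" "periodic h" and r: "\<not> p dvd r"
  shows "(\<Sum>m\<in>units. \<Sum>a\<in>units. \<Sum>d\<in>units. P (m * a\<^sup>2) * Q (m * d\<^sup>2) * h (a * \<alpha> - d * \<beta>))
    = (\<Sum>m\<in>units. \<Sum>a\<in>units. \<Sum>d\<in>units. P (m * a\<^sup>2) * Q (m * d\<^sup>2) * h (r * (a * \<alpha> - d * \<beta>)))"
proof -
  have P: "P (x mod p * y) = P (x * y)" "P (y * (x mod p)) = P (y * x)"
    "P (y * (x mod p)\<^sup>2) = P (y * x\<^sup>2)" for x y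
    by (intro periodic_cong[OF assms(1)] cong_mod_intros)+
  have Q: "Q (x mod p * y) = Q (x * y)" "Q (y * (x mod p)) = Q (y * x)"
    "Q (y * (x mod p)\<^sup>2) = Q (y * x\<^sup>2)" for x y
    by (intro periodic_cong[OF assms(2)] cong_mod_intros)+
  have h: "h (x mod p * \<alpha> - y) = h (x * \<alpha> - y)" "h (y - x mod p * \<beta>) = h (y - x * \<beta>)" for x y
    by (intro periodic_cong[OF assms(3)] cong_mod_intros)+
  have "(\<Sum>m\<in>units. \<Sum>a\<in>units. \<Sum>d\<in>units. P (m * a\<^sup>2) * Q (m * d\<^sup>2) * h (a * \<alpha> - d * \<beta>))
    = (\<Sum>m\<in>units. \<Sum>a\<in>units. \<Sum>d\<in>units. P (m * (r * a)\<^sup>2) * Q (m * d\<^sup>2) * h (r * a * \<alpha> - d * \<beta>))"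
    by (intro sum.cong[OF refl] sum_units_scale[symmetric] r) (simp add: periodic_def P h)
  also have "\<dots> = (\<Sum>m\<in>units. \<Sum>a\<in>units. \<Sum>d\<in>units.
      P (m * (r * a)\<^sup>2) * Q (m * (r * d)\<^sup>2) * h (r * a * \<alpha> - r * d * \<beta>))"
    by (intro sum.cong[OF refl] sum_units_scale[symmetric] r) (simp add: periodic_def Q h)
  also have "\<dots> = (\<Sum>a\<in>units. \<Sum>d\<in>units. \<Sum>m\<in>units.
      P (m * (r * a)\<^sup>2) * Q (m * (r * d)\<^sup>2) * h (r * a * \<alpha> - r * d * \<beta>))"
    by (rule sum_rotate)
  also have "\<dots> = (\<Sum>a\<in>units. \<Sum>d\<in>units. \<Sum>m\<in>units.
      P (r\<^sup>2 * m * a\<^sup>2) * Q (r\<^sup>2 * m * d\<^sup>2) * h (r * (a * \<alpha> - d * \<beta>)))"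
    by (simp add: power_mult_distrib algebra_simps)
  also have "\<dots> = (\<Sum>a\<in>units. \<Sum>d\<in>units. \<Sum>m\<in>units.
      P (m * a\<^sup>2) * Q (m * d\<^sup>2) * h (r * (a * \<alpha> - d * \<beta>)))"
    using r by (intro sum.cong[OF refl] sum_units_scale) (simp_all add: periodic_def P Q)
  also have "\<dots> = (\<Sum>m\<in>units. \<Sum>a\<in>units. \<Sum>d\<in>units.
      P (m * a\<^sup>2) * Q (m * d\<^sup>2) * h (r * (a * \<alpha> - d * \<beta>)))"
    by (rule sum_rotate[symmetric])
  finally show ?thesis .
qed

text \<open>The factor p - 1 is spent as a sum over r, with one rescaled copy of the triple sum for
  each r, so the averaging needs no division. The sum over r then acts on the exponential
  alone.\<close>

lemma sum_norm_square:
  assumes k: "\<not> p dvd k"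
  shows "of_int (p - 1) * complex_of_real (\<Sum>m\<in>units. \<Sum>l\<in>units. (cmod
        (\<Sum>a\<in>units. \<Sum>s\<in>units. of_bool (admissible l s (m * a\<^sup>2)) * additive_char k (a * (1 - s))))\<^sup>2)
    = of_int (p * (\<Sum>l\<in>units. \<Sum>s\<in>units. \<Sum>t\<in>units. \<Sum>m\<in>units. \<Sum>a\<in>units. \<Sum>d\<in>units.
          of_bool (admissible l s (m * a\<^sup>2)) * of_bool (admissible l t (m * d\<^sup>2))
            * of_bool (a * (1 - s) \<simeq> d * (1 - t)))
        - (\<Sum>m\<in>units. \<Sum>l\<in>units.
            (\<Sum>s\<in>units. \<Sum>a\<in>units. of_bool (admissible l s (m * a\<^sup>2)))\<^sup>2))"
proof -
  define adm :: "int \<Rightarrow> int \<Rightarrow> int \<Rightarrow> complex" where "adm l s x = of_bool (admissible l s x)" for l s x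
  define e where "e = additive_char k"
  have per: "periodic (adm l s)" for l s
    using periodic_admissible[of l s] by (simp add: periodic_def adm_def)
  have "complex_of_real ((cmod (\<Sum>a\<in>units. \<Sum>s\<in>units. adm l s (m * a\<^sup>2) * e (a * (1 - s))))\<^sup>2)
    = (\<Sum>s\<in>units. \<Sum>t\<in>units. \<Sum>a\<in>units. \<Sum>d\<in>units.
        adm l s (m * a\<^sup>2) * adm l t (m * d\<^sup>2) * e (a * (1 - s) - d * (1 - t)))" for l m
  proof -
    have "(\<Sum>a\<in>units. \<Sum>s\<in>units. adm l s (m * a\<^sup>2) * e (a * (1 - s)))
      = (\<Sum>s\<in>units. \<Sum>a\<in>units. adm l s (m * a\<^sup>2) * e (a * (1 - s)))"
      by (rule sum.swap)
    moreover have "cnj (adm l s x) = adm l s x" for s x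
      by (simp add: adm_def)
    ultimately show ?thesis
      unfolding e_def additive_char_diff
      by (simp only: complex_norm_square cnj_sum sum_product complex_cnj_mult mult_ac)
  qed
  then have "of_int (p - 1) * complex_of_real (\<Sum>m\<in>units. \<Sum>l\<in>units. (cmod
        (\<Sum>a\<in>units. \<Sum>s\<in>units. adm l s (m * a\<^sup>2) * e (a * (1 - s))))\<^sup>2)
    = of_int (p - 1) * (\<Sum>m\<in>units. \<Sum>l\<in>units. \<Sum>s\<in>units. \<Sum>t\<in>units. \<Sum>a\<in>units. \<Sum>d\<in>units.
        adm l s (m * a\<^sup>2) * adm l t (m * d\<^sup>2) * e (a * (1 - s) - d * (1 - t)))"
    by (simp only: of_real_sum)
  also have "\<dots> = of_int (p - 1) * (\<Sum>l\<in>units. \<Sum>s\<in>units. \<Sum>t\<in>units. \<Sum>m\<in>units. \<Sum>a\<in>units. \<Sum>d\<in>units.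
        adm l s (m * a\<^sup>2) * adm l t (m * d\<^sup>2) * e (a * (1 - s) - d * (1 - t)))"
    by (subst sum.swap, rule arg_cong[of _ _ "(*) _"], rule sum.cong[OF refl], rule sum_rotate)
  also have "\<dots> = (\<Sum>l\<in>units. \<Sum>s\<in>units. \<Sum>t\<in>units. of_int (p - 1) * (\<Sum>m\<in>units. \<Sum>a\<in>units. \<Sum>d\<in>units.
        adm l s (m * a\<^sup>2) * adm l t (m * d\<^sup>2) * e (a * (1 - s) - d * (1 - t))))"
    by (simp only: sum_distrib_left)
  also have "\<dots> = (\<Sum>l\<in>units. \<Sum>s\<in>units. \<Sum>t\<in>units. \<Sum>m\<in>units. \<Sum>a\<in>units. \<Sum>d\<in>units.
        adm l s (m * a\<^sup>2) * adm l t (m * d\<^sup>2)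
          * of_int (p * of_bool (a * (1 - s) \<simeq> d * (1 - t)) - 1))"
  proof (intro sum.cong[OF refl])
    fix l s t
    have "of_int (p - 1) * (\<Sum>m\<in>units. \<Sum>a\<in>units. \<Sum>d\<in>units.
        adm l s (m * a\<^sup>2) * adm l t (m * d\<^sup>2) * e (a * (1 - s) - d * (1 - t)))
      = (\<Sum>r\<in>units. \<Sum>m\<in>units. \<Sum>a\<in>units. \<Sum>d\<in>units.
        adm l s (m * a\<^sup>2) * adm l t (m * d\<^sup>2) * e (a * (1 - s) - d * (1 - t)))"
      using p_gt_3 by simp
    also have "\<dots> = (\<Sum>r\<in>units. \<Sum>m\<in>units. \<Sum>a\<in>units. \<Sum>d\<in>units.
        adm l s (m * a\<^sup>2) * adm l t (m * d\<^sup>2) * e (r * (a * (1 - s) - d * (1 - t))))"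
      by (intro sum.cong[OF refl] sum_units3_rescale per not_dvd_units)
        (simp_all add: e_def periodic_additive_char)
    also have "\<dots> = (\<Sum>m\<in>units. \<Sum>a\<in>units. \<Sum>r\<in>units. \<Sum>d\<in>units.
        adm l s (m * a\<^sup>2) * adm l t (m * d\<^sup>2) * e (r * (a * (1 - s) - d * (1 - t))))"
      by (rule sum_rotate)
    also have "\<dots> = (\<Sum>m\<in>units. \<Sum>a\<in>units. \<Sum>d\<in>units. \<Sum>r\<in>units.
        adm l s (m * a\<^sup>2) * adm l t (m * d\<^sup>2) * e (r * (a * (1 - s) - d * (1 - t))))"
      by (intro sum.cong[OF refl] sum.swap)
    also have "\<dots> = (\<Sum>m\<in>units. \<Sum>a\<in>units. \<Sum>d\<in>units.
        adm l s (m * a\<^sup>2) * adm l t (m * d\<^sup>2)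
          * of_int (p * of_bool (a * (1 - s) \<simeq> d * (1 - t)) - 1))"
      unfolding e_def additive_char_def sum_distrib_left[symmetric] sum_additive_character[OF k]
        cong_iff_dvd ..
    finally show "of_int (p - 1) * (\<Sum>m\<in>units. \<Sum>a\<in>units. \<Sum>d\<in>units.
        adm l s (m * a\<^sup>2) * adm l t (m * d\<^sup>2) * e (a * (1 - s) - d * (1 - t)))
      = (\<Sum>m\<in>units. \<Sum>a\<in>units. \<Sum>d\<in>units.
        adm l s (m * a\<^sup>2) * adm l t (m * d\<^sup>2)
          * of_int (p * of_bool (a * (1 - s) \<simeq> d * (1 - t)) - 1))" .
  qed
  also have "\<dots> = of_int (p * (\<Sum>l\<in>units. \<Sum>s\<in>units. \<Sum>t\<in>units. \<Sum>m\<in>units. \<Sum>a\<in>units. \<Sum>d\<in>units.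
          of_bool (admissible l s (m * a\<^sup>2)) * of_bool (admissible l t (m * d\<^sup>2))
            * of_bool (a * (1 - s) \<simeq> d * (1 - t))))
      - (\<Sum>l\<in>units. \<Sum>s\<in>units. \<Sum>t\<in>units. \<Sum>m\<in>units. \<Sum>a\<in>units. \<Sum>d\<in>units.
          adm l s (m * a\<^sup>2) * adm l t (m * d\<^sup>2))"
    unfolding adm_def of_int_mult of_int_sum of_int_of_bool of_int_diff of_int_1 sum_distrib_left
      sum_subtractf[symmetric]
    by (intro sum.cong[OF refl]) (simp add: right_diff_distrib mult_ac)
  also have "(\<Sum>l\<in>units. \<Sum>s\<in>units. \<Sum>t\<in>units. \<Sum>m\<in>units. \<Sum>a\<in>units. \<Sum>d\<in>units.
          adm l s (m * a\<^sup>2) * adm l t (m * d\<^sup>2))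
    = (\<Sum>l\<in>units. \<Sum>m\<in>units. \<Sum>s\<in>units. \<Sum>t\<in>units. \<Sum>a\<in>units. \<Sum>d\<in>units.
          adm l s (m * a\<^sup>2) * adm l t (m * d\<^sup>2))"
    by (rule sum.cong[OF refl], rule sum_rotate[symmetric])
  \<comment> \<open>With no condition linking a and d, the sums over (s, a) and (t, d) separate into
    equal factors.\<close>
  also have "\<dots> = (\<Sum>m\<in>units. \<Sum>l\<in>units. (\<Sum>s\<in>units. \<Sum>a\<in>units. adm l s (m * a\<^sup>2))\<^sup>2)"
    by (subst sum.swap) (simp only: power2_eq_square sum_product)
  finally show ?thesis
    by (simp only: adm_def e_def of_int_diff of_int_mult of_int_sum of_int_of_bool of_int_power)
qed

subsection \<open>Legendre symbols and the sum \<open>T\<^sub>L\<close>\<close>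

lemma Legendre_eq_0_iff: "Legendre a p = 0 \<longleftrightarrow> p dvd a"
  by (simp add: Legendre_def cong_0_iff)

lemma Legendre_range: "Legendre a p \<in> {-1, 0, 1}"
  by (simp add: Legendre_def)

lemma Legendre_cong:
  assumes "a \<simeq> b"
  shows "Legendre a p = Legendre b p"
  using assms by (simp add: Legendre_def QuadRes_def cong_def)

text \<open>Euler's criterion gives a congruence modulo p. Both sides lie in {-1, 0, 1}, so they
  differ by at most 2 < p and are equal.\<close>

lemma Legendre_mult: "Legendre (a * b) p = Legendre a p * Legendre b p"
proof -
  define h where "h = (nat p - 1) div 2"
  have euler: "Legendre x p \<simeq> x ^ h" for x
    using euler_criterion[of "nat p" x] prime p_gt_3 by (simp add: h_def)
  have "(a * b) ^ h \<simeq> Legendre a p * Legendre b p"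
    unfolding power_mult_distrib using euler by (intro cong_mult) (simp_all add: cong_sym)
  with euler[of "a * b"] have "p dvd Legendre (a * b) p - Legendre a p * Legendre b p"
    using cong_trans by (metis cong_iff_dvd)
  moreover have "\<bar>Legendre (a * b) p - Legendre a p * Legendre b p\<bar> \<le> 2"
    using Legendre_range[of a] Legendre_range[of b] Legendre_range[of "a * b"] by auto
  ultimately show ?thesis
    using p_gt_3 dvd_imp_le_int[of "Legendre (a * b) p - Legendre a p * Legendre b p" p] by fastforce
qed

lemma Legendre_square: "Legendre (a\<^sup>2) p = of_bool (\<not> p dvd a)"
  using Legendre_range[of a] Legendre_eq_0_iff[of a]
  by (auto simp: power2_eq_square Legendre_mult)

lemma card_units: "int (card units) = p - 1"
  using p_gt_3 by simp

lemma plus_1_dvd_iff: "y \<in> units \<Longrightarrow> p dvd y + 1 \<longleftrightarrow> y = p - 1"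
proof -
  assume y: "y \<in> units"
  have "p dvd y + 1 \<longleftrightarrow> p dvd y - (p - 1)"
    using dvd_diff_left_iff[of p p "y + 1"] by (simp add: algebra_simps)
  then show ?thesis
    using y p_gt_3 units_cong_iff[of y "p - 1"] by (simp add: cong_iff_dvd)
qed

lemma square_cong_1_iff:
  assumes "s \<in> units"
  shows "p dvd s\<^sup>2 - 1 \<longleftrightarrow> s = 1 \<or> s = p - 1"
proof -
  have "s\<^sup>2 - 1 = (s - 1) * (s + 1)"
    by (simp add: power2_eq_square algebra_simps)
  moreover have "p dvd s - 1 \<longleftrightarrow> s = 1"
    using assms p_gt_3 units_cong_iff[of s 1] by (simp add: cong_iff_dvd)
  moreover have "p dvd s + 1 \<longleftrightarrow> s = p - 1"
    using assms by (rule plus_1_dvd_iff)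
  ultimately show ?thesis by simp
qed

text \<open>A root y yields exactly the two roots y and -y, distinct because p is odd.\<close>

lemma count_square:
  assumes c: "\<not> p dvd c"
  shows "(\<Sum>a\<in>units. of_bool (a\<^sup>2 \<simeq> c)) = 1 + Legendre c p"
proof (cases "QuadRes p c")
  case False
  then have "\<not> a\<^sup>2 \<simeq> c" for a
    by (auto simp: QuadRes_def)
  with False c show ?thesis
    by (simp add: Legendre_def cong_0_iff)
next
  case True
  then obtain y where y: "y\<^sup>2 \<simeq> c" by (auto simp: QuadRes_def)
  then have "\<not> p dvd y"
    using c cong_dvd_iff[OF y] by simp
  have "a\<^sup>2 \<simeq> c \<longleftrightarrow> a = y mod p \<or> a = (- y) mod p" if "a \<in> units" for a
  proof -
    have "a\<^sup>2 \<simeq> c \<longleftrightarrow> p dvd a\<^sup>2 - y\<^sup>2"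
      using y by (metis cong_iff_dvd cong_sym cong_trans)
    also have "a\<^sup>2 - y\<^sup>2 = (a - y) * (a - (- y))"
      by (simp add: power2_eq_square algebra_simps)
    also have "p dvd \<dots> \<longleftrightarrow> a \<simeq> y \<or> a \<simeq> - y"
      by (simp add: cong_iff_dvd)
    also have "\<dots> \<longleftrightarrow> a = y mod p \<or> a = (- y) mod p"
      using that by (auto simp: cong_def)
    finally show ?thesis .
  qed
  then have "(\<Sum>a\<in>units. of_bool (a\<^sup>2 \<simeq> c)) = (\<Sum>a\<in>units. of_bool (a = y mod p \<or> a = (- y) mod p) :: int)"
    by (intro sum.cong) simp_all
  also have "\<dots> = (\<Sum>a\<in>{y mod p, (- y) mod p}. 1)"
    using mod_in_units[of y] mod_in_units[of "- y"] \<open>\<not> p dvd y\<close>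
    by (intro sum.mono_neutral_cong_right) auto
  also have "\<dots> = 2"
  proof -
    have "y mod p \<noteq> (- y) mod p"
    proof
      assume "y mod p = (- y) mod p"
      then have "p dvd 2 * y"
        using cong_iff_dvd[of y "- y"] by (simp add: cong_def)
      with \<open>\<not> p dvd y\<close> show False by simp
    qed
    then show ?thesis by simp
  qed
  finally show ?thesis
    using True c by (simp add: Legendre_def cong_0_iff)
qed

text \<open>Multiplication by a turns the congruence into (a x)^2 = a b, and a x runs over all
  nonzero residues.\<close>

lemma count_linear_square:
  assumes "\<not> p dvd a" "\<not> p dvd b"
  shows "(\<Sum>x\<in>units. of_bool (a * x\<^sup>2 \<simeq> b)) = 1 + Legendre (a * b) p"
proof -
  have "(\<Sum>x\<in>units. of_bool ((a * x)\<^sup>2 \<simeq> a * b)) = (\<Sum>x\<in>units. of_bool (x\<^sup>2 \<simeq> a * b) :: int)"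
    using assms by (intro sum_units_scale periodicI arg_cong[of _ _ of_bool] cong_p_eqI cong_mod_intros)
  moreover have "(a * x)\<^sup>2 \<simeq> a * b \<longleftrightarrow> a * x\<^sup>2 \<simeq> b" for x
  proof -
    have "(a * x)\<^sup>2 - a * b = a * (a * x\<^sup>2 - b)"
      by (simp add: power2_eq_square algebra_simps)
    then show ?thesis
      using assms by (simp add: cong_iff_dvd)
  qed
  ultimately show ?thesis
    using count_square[of "a * b"] assms by (simp only: p_dvd_mult_iff simp_thms)
qed

text \<open>The terms 1 + Legendre symbol of m count the pairs (a, m) with a^2 = m. Each a has one
  m, so the total p - 1 is used up by the ones.\<close>

lemma sum_Legendre_scaled:
  assumes "\<not> p dvd c"
  shows "(\<Sum>m\<in>units. Legendre (c * m) p) = 0"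
proof -
  have "(\<Sum>m\<in>units. 1 + Legendre m p) = (\<Sum>m\<in>units. \<Sum>a\<in>units. of_bool (a\<^sup>2 \<simeq> m))"
    by (intro sum.cong refl count_square[symmetric] not_dvd_units)
  also have "\<dots> = (\<Sum>a\<in>units. \<Sum>m\<in>units. of_bool (a\<^sup>2 \<simeq> m))"
    by (rule sum.swap)
  also have "\<dots> = (\<Sum>a\<in>units. 1)"
  proof (rule sum.cong[OF refl])
    fix a assume a: "a \<in> units"
    have *: "a\<^sup>2 mod p \<in> units"
      using not_dvd_units[OF a] by (intro mod_in_units) simp
    have "(\<Sum>m\<in>units. of_bool (a\<^sup>2 \<simeq> m)) = (\<Sum>m\<in>units. of_bool (m = a\<^sup>2 mod p) :: int)"
      by (intro sum.cong refl) (auto simp: cong_def)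
    then show "(\<Sum>m\<in>units. of_bool (a\<^sup>2 \<simeq> m)) = (1 :: int)"
      using * card_units_of_bool by simp
  qed
  finally have "(\<Sum>m\<in>units. Legendre m p) = 0"
    by (simp add: sum.distrib)
  moreover have "(\<Sum>m\<in>units. Legendre (c * m) p) = (\<Sum>m\<in>units. Legendre m p)"
    using assms by (intro sum_units_scale periodicI Legendre_cong cong_mod_p)
  ultimately show ?thesis by simp
qed

section \<open>Counting the admissible a for fixed l, s and m\<close>

lemma inverse_dvd: "a \<in> units \<Longrightarrow> p dvd a * modular_inverse p a - 1"
  using mult_inverse[OF not_dvd_units] by (simp add: cong_iff_dvd)

text \<open>Since s^2 = 1, the congruence factors as (s - l)(x + 1) = 0, and x = -1 is
  excluded.\<close>

lemma admissible_pm1: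
  assumes "l \<in> units" "s \<in> units" "s = 1 \<or> s = p - 1"
  shows "admissible l s x \<longleftrightarrow> l = s \<and> \<not> p dvd x + 1"
proof -
  have s2: "p dvd l * x * (s\<^sup>2 - 1)"
    using assms square_cong_1_iff[of s] by (intro dvd_mult) blast
  have "p dvd x * s * (1 - l * s) - (l - s) \<longleftrightarrow> p dvd x * s * (1 - l * s) - (l - s) + l * x * (s\<^sup>2 - 1)"
    using s2 by (simp only: dvd_add_left_iff)
  also have "x * s * (1 - l * s) - (l - s) + l * x * (s\<^sup>2 - 1) = (s - l) * (x + 1)"
    by (simp add: power2_eq_square algebra_simps)
  also have "p dvd \<dots> \<longleftrightarrow> l = s \<or> p dvd x + 1"
    using units_cong_iff[OF assms(2,1)] by (auto simp: cong_iff_dvd)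
  finally show ?thesis
    unfolding admissible_def cong_iff_dvd by blast
qed

text \<open>At x = -1 the congruence would become l x (s^2 - 1) = 0, so a nonzero solution x is
  never -1. Likewise l = s or l s = 1 would force s^2 = 1.\<close>

lemma admissible_not_pm1:
  assumes "l \<in> units" "s \<in> units" "s \<noteq> 1" "s \<noteq> p - 1" "\<not> p dvd x"
  shows "admissible l s x \<longleftrightarrow> x * s * (1 - l * s) \<simeq> l - s"
    and "admissible l s x \<Longrightarrow> l \<noteq> s" and "admissible l s x \<Longrightarrow> \<not> l * s \<simeq> 1"
proof -
  have nd: "\<not> p dvd s\<^sup>2 - 1" "\<not> p dvd l" "\<not> p dvd s"
    using square_cong_1_iff[OF assms(2)] assms by (auto simp: not_dvd_units)
  have "\<not> p dvd x + 1" if "p dvd x * s * (1 - l * s) - (l - s)"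
  proof
    assume "p dvd x + 1"
    then have "p dvd (s - l) * (x + 1) - (x * s * (1 - l * s) - (l - s))"
      using that by (simp only: dvd_diff dvd_mult)
    also have "(s - l) * (x + 1) - (x * s * (1 - l * s) - (l - s)) = l * x * (s\<^sup>2 - 1)"
      by (simp add: power2_eq_square algebra_simps)
    finally show False
      using nd assms by simp
  qed
  then show *: "admissible l s x \<longleftrightarrow> x * s * (1 - l * s) \<simeq> l - s"
    unfolding admissible_def cong_iff_dvd by blast
  show "l \<noteq> s" if "admissible l s x"
  proof
    assume "l = s"
    have "p dvd x * s * (1 - l * s) - (l - s)"
      using that by (simp only: * cong_iff_dvd)
    with \<open>l = s\<close> have "p dvd x * s * (1 - s * s)"
      by simp
    then have "p dvd 1 - s * s"
      using nd assms by simp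
    with nd(1) show False
      by (metis dvd_diff_commute power2_eq_square)
  qed
  show "\<not> l * s \<simeq> 1" if "admissible l s x"
  proof
    assume ls: "l * s \<simeq> 1"
    then have "p dvd x * s * (1 - l * s)"
      by (simp add: cong_iff_dvd dvd_diff_commute)
    moreover have "p dvd x * s * (1 - l * s) - (l - s)"
      using that by (simp add: * cong_iff_dvd)
    ultimately have "p dvd l - s"
      by (simp only: dvd_diff_right_iff)
    with ls have "p dvd (l * s - 1) - s * (l - s)"
      by (simp only: cong_iff_dvd dvd_diff dvd_mult)
    also have "(l * s - 1) - s * (l - s) = s\<^sup>2 - 1"
      by (simp add: power2_eq_square algebra_simps)
    finally show False
      using nd by blast
  qed
qed

lemma count_not_dvd_square_plus_1:
  assumes "\<not> p dvd m"
  shows "(\<Sum>a\<in>units. of_bool (\<not> p dvd m * a\<^sup>2 + 1)) = p - 2 - Legendre (- m) p"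
proof -
  have "(\<Sum>a\<in>units. of_bool (\<not> p dvd m * a\<^sup>2 + 1)) = (\<Sum>a\<in>units. 1 - of_bool (m * a\<^sup>2 \<simeq> - 1) :: int)"
    by (intro sum.cong refl) (simp add: cong_iff_dvd)
  also have "\<dots> = (p - 1) - (\<Sum>a\<in>units. of_bool (m * a\<^sup>2 \<simeq> - 1))"
    using p_gt_3 by (simp only: sum_subtractf sum_constant card_units mult_1_right)
  also have "(\<Sum>a\<in>units. of_bool (m * a\<^sup>2 \<simeq> - 1)) = 1 + Legendre (- m) p"
    using count_linear_square[of m "- 1"] assms by simp
  finally show ?thesis by simp
qed

text \<open>For s different from 1 and -1 the equation is m s (1 - l s) a^2 = l - s. The summand of
  T_L appears for every s, so that summation over s produces the complete inner sum; at s = 1 and s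
  = -1 that summand is 1 or 0 according to l \<noteq> s or l = s, and the extra
  \<open>- Legendre (- m) p\<close> corrects for it.\<close>

lemma count_admissible:
  assumes l: "l \<in> units" and s: "s \<in> units" and m: "m \<in> units"
  shows "(\<Sum>a\<in>units. of_bool (admissible l s (m * a\<^sup>2))) =
    (if s = 1 \<or> s = p - 1 then of_bool (l = s) * (p - 2) - Legendre (- m) p
     else of_bool (l \<noteq> s \<and> \<not> l * s \<simeq> 1))
    + Legendre (- m) p * Legendre ((l * s - 1) * (l * modular_inverse p s - 1)) p"
proof -
  define i where "i = modular_inverse p s"
  have si: "p dvd s * i - 1"
    unfolding i_def by (rule inverse_dvd) fact
  have nd: "\<not> p dvd l" "\<not> p dvd s" "\<not> p dvd m"
    using l s m by (simp_all add: not_dvd_units)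
  \<comment> \<open>Multiplication by the square s^2 clears the inverse without changing the
    symbol.\<close>
  have leg: "Legendre ((l * s - 1) * (l * i - 1)) p = Legendre (s * (l * s - 1) * (l - s)) p"
  proof -
    have "p dvd s * (l * s - 1) * l * (s * i - 1)"
      using si by (rule dvd_mult)
    also have "s * (l * s - 1) * l * (s * i - 1)
        = s\<^sup>2 * ((l * s - 1) * (l * i - 1)) - s * (l * s - 1) * (l - s)"
      by (simp add: power2_eq_square algebra_simps)
    finally have "s\<^sup>2 * ((l * s - 1) * (l * i - 1)) \<simeq> s * (l * s - 1) * (l - s)"
      by (simp only: cong_iff_dvd)
    then have "Legendre (s\<^sup>2 * ((l * s - 1) * (l * i - 1))) p = Legendre (s * (l * s - 1) * (l - s)) p"
      by (rule Legendre_cong)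
    then show ?thesis
      using nd by (simp add: Legendre_mult[of "s\<^sup>2"] Legendre_square)
  qed
  have ls: "p dvd l - s \<longleftrightarrow> l = s"
    using units_cong_iff[OF l s] by (simp add: cong_iff_dvd)
  show ?thesis
  proof (cases "s = 1 \<or> s = p - 1")
    case True
    have "(\<Sum>a\<in>units. of_bool (admissible l s (m * a\<^sup>2)))
      = (\<Sum>a\<in>units. of_bool (l = s) * (of_bool (\<not> p dvd m * a\<^sup>2 + 1) :: int))"
      by (intro sum.cong refl) (simp add: admissible_pm1[OF l s True])
    also have "\<dots> = of_bool (l = s) * (p - 2 - Legendre (- m) p)"
      by (simp only: count_not_dvd_square_plus_1[OF nd(3)] flip: sum_distrib_left)
    finally have 1: "(\<Sum>a\<in>units. of_bool (admissible l s (m * a\<^sup>2)))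
      = of_bool (l = s) * (p - 2 - Legendre (- m) p)" .
    have "p dvd s\<^sup>2 - 1"
      using True square_cong_1_iff[OF s] by blast
    then have "p dvd l * (s\<^sup>2 - 1)"
      by (rule dvd_mult)
    also have "l * (s\<^sup>2 - 1) = s * (l * s - 1) - (l - s)"
      by (simp add: power2_eq_square algebra_simps)
    finally have s2: "s * (l * s - 1) \<simeq> l - s"
      by (simp only: cong_iff_dvd)
    then have "s * (l * s - 1) * (l - s) \<simeq> (l - s) * (l - s)"
      by (intro cong_mult cong_refl)
    then have "Legendre (s * (l * s - 1) * (l - s)) p = Legendre ((l - s) * (l - s)) p"
      by (rule Legendre_cong)
    also have "\<dots> = of_bool (l \<noteq> s)"
      using Legendre_square[of "l - s"] ls by (simp add: power2_eq_square)
    finally have leg': "Legendre (s * (l * s - 1) * (l - s)) p = of_bool (l \<noteq> s)" .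
    show ?thesis
      unfolding i_def[symmetric] leg leg' 1 using True by (cases "l = s") simp_all
  next
    case False
    then have s1: "s \<noteq> 1" "s \<noteq> p - 1" by auto
    have nx: "\<not> p dvd m * a\<^sup>2" if "a \<in> units" for a
      using nd not_dvd_units[OF that] by simp
    show ?thesis
    proof (cases "l \<noteq> s \<and> \<not> l * s \<simeq> 1")
      case deg: False
      then have "p dvd s * (l * s - 1) * (l - s)"
        by (auto simp: cong_iff_dvd)
      then have "Legendre (s * (l * s - 1) * (l - s)) p = 0"
        by (simp add: Legendre_eq_0_iff)
      moreover have "\<not> admissible l s (m * a\<^sup>2)" if "a \<in> units" for a
        using deg admissible_not_pm1[OF l s s1 nx[OF that]] by blast
      then have "(\<Sum>a\<in>units. of_bool (admissible l s (m * a\<^sup>2))) = (0 :: int)"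
        by (intro sum.neutral ballI) (simp only: of_bool_eq)
      ultimately show ?thesis
        unfolding i_def[symmetric] leg using False deg by auto
    next
      case gen: True
      then have gen': "\<not> p dvd l - s" "\<not> p dvd 1 - l * s"
        using ls dvd_diff_commute[of p 1 "l * s"] by (auto simp: cong_iff_dvd)
      have "(\<Sum>a\<in>units. of_bool (admissible l s (m * a\<^sup>2)))
        = (\<Sum>a\<in>units. of_bool ((m * s * (1 - l * s)) * a\<^sup>2 \<simeq> l - s))"
        by (intro sum.cong refl arg_cong[of _ _ of_bool])
          (simp add: admissible_not_pm1(1)[OF l s s1 nx] mult_ac)
      also have "\<dots> = 1 + Legendre (m * s * (1 - l * s) * (l - s)) p"
        using nd gen' by (intro count_linear_square) auto
      also have "m * s * (1 - l * s) * (l - s) = - m * (s * (l * s - 1) * (l - s))"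
        by (simp add: algebra_simps)
      also have "Legendre (- m * (s * (l * s - 1) * (l - s))) p
          = Legendre (- m) p * Legendre (s * (l * s - 1) * (l - s)) p"
        by (rule Legendre_mult)
      finally have count: "(\<Sum>a\<in>units. of_bool (admissible l s (m * a\<^sup>2)))
        = 1 + Legendre (- m) p * Legendre (s * (l * s - 1) * (l - s)) p" .
      show ?thesis
        unfolding i_def[symmetric] leg count using False gen by simp
    qed
  qed
qed

section \<open>Summation over s, and first and second moments over l\<close>

abbreviation generic_units :: "int set" where "generic_units \<equiv> units - {1, p - 1}"

lemma sum_units_split: "(\<Sum>s\<in>units. f s) = f 1 + f (p - 1) + (\<Sum>s\<in>generic_units. f s)"
proof -
  have "units = insert 1 (insert (p - 1) generic_units)"
    using p_gt_3 by auto
  then have "(\<Sum>s\<in>units. f s) = (\<Sum>s\<in>insert 1 (insert (p - 1) generic_units). f s)"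
    by (rule arg_cong)
  also have "\<dots> = f 1 + (f (p - 1) + (\<Sum>s\<in>generic_units. f s))"
    using p_gt_3 by (subst sum.insert; simp)+
  finally show ?thesis
    by (simp add: add.assoc)
qed

definition legendre_sum :: "int \<Rightarrow> int"
  where "legendre_sum l = (\<Sum>s\<in>units. Legendre ((l * s - 1) * (l * modular_inverse p s - 1)) p)"

lemma T_L_eq: "T_L p = (\<Sum>l\<in>units. (legendre_sum l)\<^sup>2)"
  by (simp add: T_L_def legendre_sum_def)

lemma card_generic_units: "int (card generic_units) = p - 3"
  using p_gt_3 by (subst card_Diff_subset) auto

text \<open>The excluded values are l and its inverse. For l = 1 or l = -1 they coincide and lie
  outside \<open>generic_units\<close> already; otherwise they are two distinct members of
  it.\<close>

lemma sum_generic_units: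
  assumes l: "l \<in> units"
  shows "(\<Sum>s\<in>generic_units. of_bool (l \<noteq> s \<and> \<not> l * s \<simeq> 1)) = p - 5 + 2 * of_bool (l = 1 \<or> l = p - 1)"
proof -
  obtain i where i: "i \<in> units" "\<And>s. s \<in> units \<Longrightarrow> l * s \<simeq> 1 \<longleftrightarrow> s = i"
    using ex1_linear[of l 1] not_dvd_units[OF l] p_not_dvd_1 by blast
  have li: "l * i \<simeq> 1"
    using i by blast
  have inv_pm1: "i = l" if "l = 1 \<or> l = p - 1"
  proof -
    have "l * l \<simeq> 1"
      using that square_cong_1_iff[OF l] by (simp add: cong_iff_dvd power2_eq_square)
    then show ?thesis
      using i(2)[OF l] by simp
  qed
  have "(\<Sum>s\<in>generic_units. of_bool (l \<noteq> s \<and> \<not> l * s \<simeq> 1)) = (\<Sum>s\<in>generic_units - {l, i}. 1 :: int)"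
    by (intro sum.mono_neutral_cong_right) (use i(2) in auto)
  also have "\<dots> = int (card (generic_units - {l, i}))"
    by simp
  also have "\<dots> = p - 5 + 2 * of_bool (l = 1 \<or> l = p - 1)"
  proof (cases "l = 1 \<or> l = p - 1")
    case True
    then have "generic_units - {l, i} = generic_units"
      using inv_pm1 by auto
    then show ?thesis
      using True card_generic_units by simp
  next
    case False
    have "i \<noteq> l"
      using square_cong_1_iff[OF l] False li by (auto simp: cong_iff_dvd power2_eq_square)
    moreover have "i \<noteq> 1 \<and> i \<noteq> p - 1"
    proof (rule ccontr)
      assume "\<not> ?thesis"
      then have ii: "p dvd i\<^sup>2 - 1"
        using square_cong_1_iff[OF i(1)] by blast
      have "p dvd i * (l * i - 1) - l * (i\<^sup>2 - 1)"
        using ii li by (intro dvd_diff) (simp_all only: cong_iff_dvd dvd_mult)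
      also have "i * (l * i - 1) - l * (i\<^sup>2 - 1) = l - i"
        by (simp add: power2_eq_square algebra_simps)
      finally show False
        using units_cong_iff[OF l i(1)] \<open>i \<noteq> l\<close> by (simp add: cong_iff_dvd)
    qed
    ultimately have "{l, i} \<subseteq> generic_units" "card {l, i} = 2"
      using l i(1) False by auto
    then have "int (card (generic_units - {l, i})) = int (card generic_units) - 2"
      using card_mono[of generic_units "{l, i}"] by (subst card_Diff_subset) auto
    then show ?thesis
      using card_generic_units False by simp
  qed
  finally show ?thesis .
qed

text \<open>The -2 collects the corrections at s = 1 and s = -1. For l = 1 or l = -1, the term s = l
  contributes p - 2 and \<open>sum_generic_units\<close> 2 more, together p.\<close>

lemma sum_admissible:
  assumes l: "l \<in> units" and m: "m \<in> units"
  shows "(\<Sum>s\<in>units. \<Sum>a\<in>units. of_bool (admissible l s (m * a\<^sup>2)))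
    = p - 5 + p * of_bool (l = 1 \<or> l = p - 1) + Legendre (- m) p * (legendre_sum l - 2)"
proof -
  define f where "f s = (if s = 1 \<or> s = p - 1 then of_bool (l = s) * (p - 2) - Legendre (- m) p
     else of_bool (l \<noteq> s \<and> \<not> l * s \<simeq> 1))" for s
  have "(\<Sum>s\<in>units. \<Sum>a\<in>units. of_bool (admissible l s (m * a\<^sup>2))) =
    (\<Sum>s\<in>units. f s + Legendre (- m) p * Legendre ((l * s - 1) * (l * modular_inverse p s - 1)) p)"
    unfolding f_def by (intro sum.cong refl count_admissible l m)
  also have "\<dots> = (\<Sum>s\<in>units. f s) + Legendre (- m) p * legendre_sum l"
    by (simp only: sum.distrib legendre_sum_def sum_distrib_left)
  also have "(\<Sum>s\<in>units. f s) = f 1 + f (p - 1) + (\<Sum>s\<in>generic_units. f s)"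
    by (rule sum_units_split)
  also have "(\<Sum>s\<in>generic_units. f s) = (\<Sum>s\<in>generic_units. of_bool (l \<noteq> s \<and> \<not> l * s \<simeq> 1))"
    by (intro sum.cong refl) (auto simp: f_def)
  also have "\<dots> = p - 5 + 2 * of_bool (l = 1 \<or> l = p - 1)"
    by (rule sum_generic_units) fact
  finally show ?thesis
    using p_gt_3 by (auto simp: f_def algebra_simps)
qed

text \<open>The admissible triples (l, s, a) for m = -1 are counted twice. By
  \<open>sum_admissible\<close> their number involves the wanted sum; with s and a fixed first, the
  condition is linear in l and the number is (p - 3)^2.\<close>

lemma sum_legendre_sum: "(\<Sum>l\<in>units. legendre_sum l) = 2"
proof -
  \<comment> \<open>\<open>m\<close> represents -1, which makes the symbol of -m equal to 1.\<close>
  define m where "m = p - 1"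
  have m: "m \<in> units" "- m \<simeq> 1"
    using p_gt_3 by (simp_all add: m_def cong_iff_dvd)
  have "Legendre (- m) p = Legendre (1\<^sup>2) p"
    using m(2) by (intro Legendre_cong) simp
  then have L1: "Legendre (- m) p = 1"
    unfolding Legendre_square by simp
  have pm: "(\<Sum>l\<in>units. of_bool (l = 1 \<or> l = p - 1)) = (2 :: int)"
    and gen: "(\<Sum>l\<in>units. of_bool (\<not> p dvd l\<^sup>2 - 1)) = p - 3"
  proof -
    show "(\<Sum>l\<in>units. of_bool (l = 1 \<or> l = p - 1)) = (2 :: int)"
      by (subst sum_units_split) simp
    have "(\<Sum>l\<in>units. of_bool (\<not> p dvd l\<^sup>2 - 1)) = (\<Sum>l\<in>generic_units. 1 :: int)"
      by (intro sum.mono_neutral_cong_right) (auto simp: square_cong_1_iff)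
    then show "(\<Sum>l\<in>units. of_bool (\<not> p dvd l\<^sup>2 - 1)) = p - 3"
      using card_generic_units by simp
  qed
  have "(\<Sum>l\<in>units. \<Sum>s\<in>units. \<Sum>a\<in>units. of_bool (admissible l s (m * a\<^sup>2)))
    = (\<Sum>l\<in>units. p - 5 + p * of_bool (l = 1 \<or> l = p - 1) + 1 * (legendre_sum l - 2))"
    using sum_admissible[OF _ m(1)] by (intro sum.cong refl) (simp only: L1)
  also have "\<dots> = (p - 1) * (p - 5) + p * 2 + ((\<Sum>l\<in>units. legendre_sum l) - (p - 1) * 2)"
    unfolding sum.distrib sum_distrib_left[symmetric] pm using p_gt_3 by (simp add: sum_subtractf)
  finally have 1: "(\<Sum>l\<in>units. \<Sum>s\<in>units. \<Sum>a\<in>units. of_bool (admissible l s (m * a\<^sup>2)))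
    = (p - 1) * (p - 5) + p * 2 + ((\<Sum>l\<in>units. legendre_sum l) - (p - 1) * 2)" .
  have "(\<Sum>l\<in>units. \<Sum>s\<in>units. \<Sum>a\<in>units. of_bool (admissible l s (m * a\<^sup>2)))
    = (\<Sum>s\<in>units. \<Sum>a\<in>units. \<Sum>l\<in>units. of_bool (admissible l s (m * a\<^sup>2)) :: int)"
    by (rule sum_rotate)
  also have "\<dots> = (\<Sum>s\<in>units. \<Sum>a\<in>units. of_bool (\<not> p dvd a\<^sup>2 - 1) * of_bool (\<not> p dvd (a * s)\<^sup>2 - 1))"
  proof (intro sum.cong refl)
    fix s a assume as: "s \<in> units" "a \<in> units"
    have neg: "p dvd m * x + 1 \<longleftrightarrow> p dvd x - 1" for x
    proof -
      have "p dvd m * x + 1 \<longleftrightarrow> p dvd (p * x - (m * x + 1))"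
        by (simp only: dvd_diff_right_iff dvd_triv_left)
      then show ?thesis
        by (simp add: m_def algebra_simps)
    qed
    define x where "x = m * a\<^sup>2"
    have x1: "p dvd x + 1 \<longleftrightarrow> p dvd a\<^sup>2 - 1" and x2: "p dvd x * s\<^sup>2 + 1 \<longleftrightarrow> p dvd (a * s)\<^sup>2 - 1"
      using neg[of "a\<^sup>2"] neg[of "(a * s)\<^sup>2"] by (simp_all add: x_def power_mult_distrib mult_ac)
    \<comment> \<open>The congruence is solved for l: there is exactly one nonzero l if x + 1 and x
      s^2 + 1 are both nonzero, and no admissible l otherwise.\<close>
    have adm: "admissible l s x \<longleftrightarrow> \<not> p dvd x + 1 \<and> (x * s\<^sup>2 + 1) * l \<simeq> s * (x + 1)" for l
    proof -
      have "(x * s\<^sup>2 + 1) * l - s * (x + 1) = - (x * s * (1 - l * s) - (l - s))"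
        by (simp add: power2_eq_square algebra_simps)
      then show ?thesis
        unfolding admissible_def cong_iff_dvd by (simp only: dvd_minus_iff)
    qed
    show "(\<Sum>l\<in>units. of_bool (admissible l s (m * a\<^sup>2)))
      = (of_bool (\<not> p dvd a\<^sup>2 - 1) * of_bool (\<not> p dvd (a * s)\<^sup>2 - 1) :: int)"
      unfolding x_def[symmetric] x1[symmetric] x2[symmetric]
    proof (cases "p dvd x + 1 \<or> p dvd x * s\<^sup>2 + 1")
      case True
      have "\<not> admissible l s x" for l
      proof
        assume l: "admissible l s x"
        then have "p dvd x * s\<^sup>2 + 1" "p dvd (x * s\<^sup>2 + 1) * l - s * (x + 1)"
          using True by (simp_all only: adm cong_iff_dvd) auto
        then have "p dvd s * (x + 1)"
          by (simp only: dvd_diff_right_iff dvd_mult2)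
        with l show False
          using not_dvd_units[OF as(1)] by (simp add: adm)
      qed
      with True show "(\<Sum>l\<in>units. of_bool (admissible l s x))
        = (of_bool (\<not> p dvd x + 1) * of_bool (\<not> p dvd x * s\<^sup>2 + 1) :: int)"
        by auto
    next
      case False
      then obtain l0 where "l0 \<in> units" "\<And>l. l \<in> units \<Longrightarrow> (x * s\<^sup>2 + 1) * l \<simeq> s * (x + 1) \<longleftrightarrow> l = l0"
        using ex1_linear[of "x * s\<^sup>2 + 1" "s * (x + 1)"] not_dvd_units[OF as(1)] by auto
      then have "(\<Sum>l\<in>units. of_bool (admissible l s x) * 1) = (1 :: int)"
        using False by (intro sum_of_bool_unique) (auto simp: adm)
      with False show "(\<Sum>l\<in>units. of_bool (admissible l s x))
        = (of_bool (\<not> p dvd x + 1) * of_bool (\<not> p dvd x * s\<^sup>2 + 1) :: int)"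
        by simp
    qed
  qed
  also have "\<dots> = (\<Sum>a\<in>units. \<Sum>s\<in>units. of_bool (\<not> p dvd a\<^sup>2 - 1) * of_bool (\<not> p dvd (a * s)\<^sup>2 - 1))"
    by (rule sum.swap)
  also have "\<dots> = (\<Sum>a\<in>units. of_bool (\<not> p dvd a\<^sup>2 - 1) * (p - 3))"
  proof (intro sum.cong refl)
    fix a assume a: "a \<in> units"
    have "(\<Sum>s\<in>units. of_bool (\<not> p dvd (a * s)\<^sup>2 - 1)) = (\<Sum>s\<in>units. of_bool (\<not> p dvd s\<^sup>2 - 1) :: int)"
      by (intro sum_units_scale not_dvd_units[OF a] periodicI arg_cong[of _ _ of_bool]
          arg_cong[of _ _ Not] cong_dvd_iff cong_mod_intros)
    then show "(\<Sum>s\<in>units. of_bool (\<not> p dvd a\<^sup>2 - 1) * of_bool (\<not> p dvd (a * s)\<^sup>2 - 1))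
      = of_bool (\<not> p dvd a\<^sup>2 - 1) * (p - 3)"
      by (simp only: gen flip: sum_distrib_left)
  qed
  also have "\<dots> = (p - 3) * (p - 3)"
    by (simp only: gen flip: sum_distrib_right)
  finally show ?thesis
    unfolding 1 by (simp add: algebra_simps)
qed

text \<open>With L the symbol of -m, the square of c + L d is c^2 + d^2 + 2 c d L because L^2 = 1;
  the cross term vanishes in the sum over m.\<close>

lemma sum_admissible_square:
  "(\<Sum>m\<in>units. \<Sum>l\<in>units. (\<Sum>s\<in>units. \<Sum>a\<in>units. of_bool (admissible l s (m * a\<^sup>2)))\<^sup>2)
    = (p - 1) * (p ^ 3 - 5 * p\<^sup>2 + 19 * p - 37 + T_L p)"
proof -
  define c d where "c l = p - 5 + p * of_bool (l = 1 \<or> l = p - 1)"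
    and "d l = legendre_sum l - 2" for l
  have "(\<Sum>m\<in>units. \<Sum>l\<in>units. (\<Sum>s\<in>units. \<Sum>a\<in>units. of_bool (admissible l s (m * a\<^sup>2)))\<^sup>2)
    = (\<Sum>m\<in>units. \<Sum>l\<in>units. (c l)\<^sup>2 + (d l)\<^sup>2 + 2 * c l * d l * Legendre (- m) p)"
  proof (intro sum.cong refl)
    fix m l assume ml: "m \<in> units" "l \<in> units"
    have "Legendre (- m) p * Legendre (- m) p = 1"
      using Legendre_square[of "- m"] not_dvd_units[OF ml(1)]
      by (simp add: power2_eq_square flip: Legendre_mult)
    moreover have "(c l + Legendre (- m) p * d l)\<^sup>2 = (c l)\<^sup>2
      + (Legendre (- m) p * Legendre (- m) p) * (d l)\<^sup>2 + 2 * c l * d l * Legendre (- m) p"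
      by (simp add: power2_eq_square algebra_simps)
    ultimately show "(\<Sum>s\<in>units. \<Sum>a\<in>units. of_bool (admissible l s (m * a\<^sup>2)))\<^sup>2
      = (c l)\<^sup>2 + (d l)\<^sup>2 + 2 * c l * d l * Legendre (- m) p"
      unfolding sum_admissible[OF ml(2,1)] c_def[symmetric] d_def[symmetric] by simp
  qed
  also have "\<dots> = (\<Sum>l\<in>units. \<Sum>m\<in>units. (c l)\<^sup>2 + (d l)\<^sup>2 + 2 * c l * d l * Legendre (- m) p)"
    by (rule sum.swap)
  also have "\<dots> = (\<Sum>l\<in>units. (p - 1) * ((c l)\<^sup>2 + (d l)\<^sup>2))"
  proof (rule sum.cong[OF refl])
    fix l
    have "(\<Sum>m\<in>units. Legendre (- m) p) = 0"
      using sum_Legendre_scaled[of "- 1"] by simp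
    then show "(\<Sum>m\<in>units. (c l)\<^sup>2 + (d l)\<^sup>2 + 2 * c l * d l * Legendre (- m) p)
      = (p - 1) * ((c l)\<^sup>2 + (d l)\<^sup>2)"
      using p_gt_3 by (simp add: sum.distrib flip: sum_distrib_left)
  qed
  also have "\<dots> = (p - 1) * ((\<Sum>l\<in>units. (c l)\<^sup>2) + (\<Sum>l\<in>units. (d l)\<^sup>2))"
    by (simp only: sum.distrib flip: sum_distrib_left)
  \<comment> \<open>\<open>c\<close> equals 2 p - 5 at l = 1 and l = -1, and p - 5 at the other p -
    3 values.\<close>
  also have "(\<Sum>l\<in>units. (c l)\<^sup>2) = 2 * (2 * p - 5)\<^sup>2 + (p - 3) * (p - 5)\<^sup>2"
  proof -
    have "(\<Sum>l\<in>generic_units. (c l)\<^sup>2) = (\<Sum>l\<in>generic_units. (p - 5)\<^sup>2)"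
      by (intro sum.cong refl) (auto simp: c_def)
    also have "\<dots> = (p - 3) * (p - 5)\<^sup>2"
      by (simp only: sum_constant card_generic_units)
    finally show ?thesis
      by (subst sum_units_split) (simp add: c_def)
  qed
  \<comment> \<open>The -8 is -4 times the first moment 2 from
    \<open>sum_legendre_sum\<close>.\<close>
  also have "(\<Sum>l\<in>units. (d l)\<^sup>2) = T_L p - 8 + 4 * (p - 1)"
  proof -
    have "(\<Sum>l\<in>units. (d l)\<^sup>2) = (\<Sum>l\<in>units. (legendre_sum l)\<^sup>2 - 4 * legendre_sum l + 4)"
      by (intro sum.cong refl) (simp add: d_def power2_eq_square algebra_simps)
    also have "\<dots> = T_L p - 4 * (\<Sum>l\<in>units. legendre_sum l) + 4 * (p - 1)"
      using p_gt_3 by (simp add: T_L_eq sum.distrib sum_subtractf sum_distrib_left)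
    finally show ?thesis
      by (simp add: sum_legendre_sum)
  qed
  finally show ?thesis
    by (simp add: power2_eq_square power3_eq_cube algebra_simps)
qed

subsection \<open>The diagonal term and the sum \<open>T\<close>\<close>

text \<open>The solutions \<open>(m, a, d)\<close> of the diagonal term with \<open>d = 1\<close> (and \<open>m = y\<close>).\<close>
definition pair_count :: "int \<Rightarrow> int \<Rightarrow> int \<Rightarrow> int"
  where "pair_count l s t = (\<Sum>y\<in>units. \<Sum>a\<in>units.
    of_bool (admissible l s (y * a\<^sup>2)) * of_bool (admissible l t y) * of_bool (a * (1 - s) \<simeq> 1 - t))"

text \<open>The summation condition of \<open>T\<close> together with \<open>\<chi>\<^sub>0 \<noteq> 0\<close>, multiplied by \<open>s t\<close> to clear inverses.\<close>
definition triple_condition :: "int \<Rightarrow> int \<Rightarrow> int \<Rightarrow> bool"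
  where "triple_condition l s t \<longleftrightarrow>
    (s - 1)\<^sup>2 * t * (l - s) * (l * t - 1) \<simeq> (t - 1)\<^sup>2 * s * (l - t) * (l * s - 1) \<and>
    \<not> p dvd (s - 1)\<^sup>2 * (l - s) * (l * t - 1)"

section \<open>Normalisation and symmetry of the diagonal count\<close>

lemma admissible_cong: "x \<simeq> y \<Longrightarrow> admissible l s x \<longleftrightarrow> admissible l s y"
  by (rule periodic_cong[OF periodic_admissible])

text \<open>Replacing a by d a and m by m / d^2 reduces every d to d = 1, so each of the p - 1
  values of d contributes the same count.\<close>

lemma sum_eq_pair_count:
  "(\<Sum>m\<in>units. \<Sum>a\<in>units. \<Sum>d\<in>units. of_bool (admissible l s (m * a\<^sup>2)) * of_bool (admissible l t (m * d\<^sup>2))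
      * of_bool (a * (1 - s) \<simeq> d * (1 - t))) = (p - 1) * pair_count l s t"
proof -
  define F :: "int \<Rightarrow> int \<Rightarrow> int \<Rightarrow> int" where
    "F m a d = of_bool (admissible l s (m * a\<^sup>2)) * of_bool (admissible l t (m * d\<^sup>2))
      * of_bool (a * (1 - s) \<simeq> d * (1 - t))" for m a d
  have F_cong: "F m a d = F m' a' d'" if "m \<simeq> m'" "a \<simeq> a'" "d \<simeq> d'" for m a d m' a' d'
    unfolding F_def using that
    by (intro arg_cong2[of _ _ _ _ "(*)"] arg_cong[of _ _ of_bool] admissible_cong cong_p_eqI
        cong_mult cong_pow cong_refl)
  have "(\<Sum>m\<in>units. \<Sum>a\<in>units. F m a d) = pair_count l s t" if d: "d \<in> units" for d
  proof -
    have nd: "\<not> p dvd d"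
      by (rule not_dvd_units) fact
    have "(\<Sum>m\<in>units. \<Sum>a\<in>units. F m a d) = (\<Sum>m\<in>units. \<Sum>a\<in>units. F m (d * a) d)"
      by (intro sum.cong refl sum_units_scale[symmetric] nd periodicI F_cong cong_mod_intros)
    also have "\<dots> = (\<Sum>m\<in>units. \<Sum>a\<in>units. F (d\<^sup>2 * m) a 1)"
    proof (intro sum.cong refl)
      fix m a
      have "d * a * (1 - s) - d * (1 - t) = d * (a * (1 - s) - (1 - t))"
        by (simp add: algebra_simps)
      then have "d * a * (1 - s) \<simeq> d * (1 - t) \<longleftrightarrow> a * (1 - s) \<simeq> 1 - t"
        using nd by (simp add: cong_iff_dvd)
      then show "F m (d * a) d = F (d\<^sup>2 * m) a 1"
        by (simp add: F_def power_mult_distrib mult_ac)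
    qed
    also have "\<dots> = (\<Sum>m\<in>units. \<Sum>a\<in>units. F m a 1)"
      using nd by (intro sum_units_scale[where g = "\<lambda>m. \<Sum>a\<in>units. F m a 1"] periodicI
          sum.cong refl F_cong cong_mod_intros) auto
    finally show ?thesis
      by (simp add: F_def pair_count_def)
  qed
  then have "(\<Sum>d\<in>units. \<Sum>m\<in>units. \<Sum>a\<in>units. F m a d) = (\<Sum>d\<in>units. pair_count l s t)"
    by (intro sum.cong refl)
  also have "\<dots> = (p - 1) * pair_count l s t"
    by (simp only: sum_constant card_units)
  finally have "(p - 1) * pair_count l s t = (\<Sum>d\<in>units. \<Sum>m\<in>units. \<Sum>a\<in>units. F m a d)" ..
  also have "\<dots> = (\<Sum>m\<in>units. \<Sum>a\<in>units. \<Sum>d\<in>units. F m a d)"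
    by (rule sum_rotate)
  finally show ?thesis
    unfolding F_def by simp
qed

text \<open>Setting d = 1 hides the symmetry between (s, a) and (t, d). It is read off from the full
  sum over m, a and d, after which p - 1 is cancelled.\<close>

lemma pair_count_commute: "pair_count l s t = pair_count l t s"
proof -
  have "(p - 1) * pair_count l s t = (\<Sum>m\<in>units. \<Sum>d\<in>units. \<Sum>a\<in>units.
      of_bool (admissible l s (m * a\<^sup>2)) * of_bool (admissible l t (m * d\<^sup>2))
      * of_bool (a * (1 - s) \<simeq> d * (1 - t)))"
    unfolding sum_eq_pair_count[symmetric] by (intro sum.cong[OF refl] sum.swap)
  also have "\<dots> = (\<Sum>m\<in>units. \<Sum>d\<in>units. \<Sum>a\<in>units.
      of_bool (admissible l t (m * d\<^sup>2)) * of_bool (admissible l s (m * a\<^sup>2))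
      * of_bool (d * (1 - t) \<simeq> a * (1 - s)))"
    by (intro sum.cong refl arg_cong2[of _ _ _ _ "(*)"] mult.commute arg_cong[of _ _ of_bool] cong_sym_eq)
  also have "\<dots> = (p - 1) * pair_count l t s"
    by (rule sum_eq_pair_count)
  finally show ?thesis
    using p_gt_3 by simp
qed

text \<open>The nonvanishing clause speaks of the left side of the congruence only; the congruence
  itself carries it over to the right side.\<close>

lemma triple_condition_commute:
  assumes "s \<in> units" "t \<in> units"
  shows "triple_condition l s t \<longleftrightarrow> triple_condition l t s"
proof -
  have *: "triple_condition l t s" if "s \<in> units" "t \<in> units" "triple_condition l s t" for s t
  proof -
    define A B where "A = (s - 1)\<^sup>2 * t * (l - s) * (l * t - 1)"
      and "B = (t - 1)\<^sup>2 * s * (l - t) * (l * s - 1)"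
    have "A \<simeq> B" "\<not> p dvd A"
      using that not_dvd_units[OF that(2)] unfolding triple_condition_def A_def B_def by auto
    then have "B \<simeq> A" "\<not> p dvd B"
      using cong_dvd_iff cong_sym by blast+
    then show ?thesis
      unfolding triple_condition_def A_def B_def by auto
  qed
  show ?thesis
    using * assms by blast
qed

section \<open>Evaluation of \<open>pair_count\<close>\<close>

lemma pm1_dvd: "t \<in> generic_units \<Longrightarrow> \<not> p dvd t - 1" "t \<in> generic_units \<Longrightarrow> \<not> p dvd 1 - t"
  "t \<in> generic_units \<Longrightarrow> \<not> p dvd t + 1"
proof -
  assume t: "t \<in> generic_units"
  have "(t - 1) * (t + 1) = t\<^sup>2 - 1"
    by (simp add: power2_eq_square algebra_simps)
  then have "\<not> p dvd (t - 1) * (t + 1)"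
    using t square_cong_1_iff[of t] by auto
  then show "\<not> p dvd t - 1" "\<not> p dvd 1 - t" "\<not> p dvd t + 1"
    by (auto simp: dvd_diff_commute)
qed

lemma sum_not_plus_1_dvd: "(\<Sum>y\<in>units. of_bool (\<not> p dvd y + 1)) = p - 2"
proof -
  have "(\<Sum>y\<in>units. of_bool (\<not> p dvd y + 1)) = (\<Sum>y\<in>units - {p - 1}. 1 :: int)"
    by (intro sum.mono_neutral_cong_right) (auto simp: plus_1_dvd_iff)
  then show ?thesis
    using p_gt_3 by simp
qed

lemma p_not_dvd_2_minus_p: "\<not> p dvd 2 - p"
  using dvd_add[of p "2 - p" p] p_not_dvd_2 by auto

text \<open>The linear condition reads 0 = 0, so pairs (y, a) with y \<noteq> -1 and y a^2 \<noteq>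
  -1 are counted. The symbols of -y add up to 0 over all y; leaving out y = -1, whose symbol is 1,
  produces the +1.\<close>

lemma pair_count_one:
  assumes "l \<in> units"
  shows "pair_count l 1 1 = of_bool (l = 1) * ((p - 2)\<^sup>2 + 1)"
proof -
  have one: "1 \<in> units" using p_gt_3 by simp
  have "pair_count l 1 1 = (\<Sum>y\<in>units. \<Sum>a\<in>units. of_bool (l = 1) *
      (of_bool (\<not> p dvd y + 1) * of_bool (\<not> p dvd y * a\<^sup>2 + 1)))"
    unfolding pair_count_def
    by (intro sum.cong refl) (use assms one in \<open>auto simp: admissible_pm1\<close>)
  also have "\<dots> = of_bool (l = 1) * (\<Sum>y\<in>units. of_bool (\<not> p dvd y + 1) *
      (\<Sum>a\<in>units. of_bool (\<not> p dvd y * a\<^sup>2 + 1)))"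
    by (simp only: sum_distrib_left)
  also have "(\<Sum>y\<in>units. of_bool (\<not> p dvd y + 1) * (\<Sum>a\<in>units. of_bool (\<not> p dvd y * a\<^sup>2 + 1)))
    = (\<Sum>y\<in>units. of_bool (\<not> p dvd y + 1) * (p - 2) - Legendre (- y) p
        + of_bool (y = p - 1) * Legendre (- y) p)"
    by (intro sum.cong refl)
      (simp only: count_not_dvd_square_plus_1[OF not_dvd_units] plus_1_dvd_iff, simp add: of_bool_def)
  also have "\<dots> = (p - 2) * (p - 2) - 0 + 1"
  proof -
    have "(\<Sum>y\<in>units. Legendre (- y) p) = 0"
      using sum_Legendre_scaled[of "- 1"] by simp
    moreover have "(\<Sum>y\<in>units. of_bool (y = p - 1) * Legendre (- y) p) = Legendre (- (p - 1)) p"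
      using p_gt_3 by (intro sum_of_bool_unique) auto
    moreover have "Legendre (- (p - 1)) p = Legendre (1\<^sup>2) p"
      by (intro Legendre_cong) (simp add: cong_iff_dvd)
    then have "Legendre (- (p - 1)) p = 1"
      unfolding Legendre_square by simp
    ultimately show ?thesis
      by (simp only: sum.distrib sum_subtractf sum_not_plus_1_dvd flip: sum_distrib_right)
  qed
  finally show ?thesis
    by (simp add: power2_eq_square)
qed

lemma pair_count_one_left:
  assumes "t \<in> units" "t \<noteq> 1"
  shows "pair_count l 1 t = 0"
proof -
  have "1 \<in> units" using p_gt_3 by simp
  then have "\<not> p dvd t - 1"
    using assms units_cong_iff[of t 1] by (simp add: cong_iff_dvd)
  then have "\<not> a * (1 - 1) \<simeq> 1 - t" for a
    by (simp add: cong_iff_dvd)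
  then show ?thesis
    unfolding pair_count_def by (simp only: of_bool_eq mult_zero_right sum.neutral_const)
qed

text \<open>\<open>1 - (p - 1)\<close> stands for 2, so the linear condition forces a = 1 and only y
  \<noteq> -1 remains.\<close>

lemma pair_count_minus_one:
  assumes "l \<in> units"
  shows "pair_count l (p - 1) (p - 1) = of_bool (l = p - 1) * (p - 2)"
proof -
  have m: "p - 1 \<in> units" using p_gt_3 by simp
  have a1: "a * (1 - (p - 1)) \<simeq> 1 - (p - 1) \<longleftrightarrow> a = 1" if "a \<in> units" for a
  proof -
    have "a * (1 - (p - 1)) - (1 - (p - 1)) = (2 - p) * (a - 1)"
      by (simp add: algebra_simps)
    then show ?thesis
      using p_not_dvd_2_minus_p that p_gt_3 units_cong_iff[of a 1] by (simp add: cong_iff_dvd)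
  qed
  have "pair_count l (p - 1) (p - 1) = (\<Sum>y\<in>units. \<Sum>a\<in>units. of_bool (a = 1) *
      (of_bool (l = p - 1) * of_bool (\<not> p dvd y + 1)))"
    unfolding pair_count_def
    by (intro sum.cong refl)
      (simp only: a1 admissible_pm1[OF assms m disjI2[OF refl]], auto)
  also have "\<dots> = (\<Sum>y\<in>units. of_bool (l = p - 1) * of_bool (\<not> p dvd y + 1))"
    using p_gt_3 by (intro sum.cong refl sum_of_bool_unique[where x = 1]) auto
  also have "\<dots> = of_bool (l = p - 1) * (p - 2)"
    by (simp only: sum_not_plus_1_dvd flip: sum_distrib_left)
  finally show ?thesis .
qed

text \<open>For l = s = -1 the unknowns are a = (1 - t)/2 and y = -1/t, and the remaining condition
  y a^2 \<noteq> -1 reads (1 - t)^2 \<noteq> 4 t.\<close>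

lemma pair_count_minus_one_left:
  assumes l: "l \<in> units" and t: "t \<in> generic_units"
  shows "pair_count l (p - 1) t = of_bool (l = p - 1) * of_bool (\<not> p dvd (1 - t)\<^sup>2 - 4 * t)"
proof (cases "l = p - 1")
  case False
  have "\<not> admissible l (p - 1) x" for x
    using False l p_gt_3 by (subst admissible_pm1) auto
  with False show ?thesis
    unfolding pair_count_def by (simp only: of_bool_eq mult_zero_left sum.neutral_const)
next
  case True
  have t': "t \<in> units" "t \<noteq> 1" "t \<noteq> p - 1" and m: "p - 1 \<in> units"
    using t p_gt_3 by auto
  have nd: "\<not> p dvd t"
    using t'(1) by (rule not_dvd_units)
  obtain a where a: "a \<in> units" "p dvd (2 - p) * a - (1 - t)"
    "\<And>g. (\<Sum>x\<in>units. of_bool ((2 - p) * x \<simeq> 1 - t) * g x) = (g a :: int)"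
    using sum_linear[OF p_not_dvd_2_minus_p pm1_dvd(2)[OF t]] by blast
  have "\<not> p dvd - 1" by simp
  then obtain y where y: "y \<in> units" "p dvd t * y - (- 1)"
    "\<And>g. (\<Sum>x\<in>units. of_bool (t * x \<simeq> - 1) * g x) = (g y :: int)"
    using sum_linear[of t "- 1"] nd by blast
  \<comment> \<open>For l = -1 the congruence is (t + 1)(t x + 1) = 0 up to a multiple of p, and t +
    1 is invertible.\<close>
  have adm: "admissible l t x \<longleftrightarrow> t * x \<simeq> - 1" if "x \<in> units" for x
  proof -
    have "p dvd p * (x * t * t + 1)" by simp
    then have "p dvd x * t * (1 - l * t) - (l - t) \<longleftrightarrow>
        p dvd x * t * (1 - l * t) - (l - t) + p * (x * t * t + 1)"
      by (simp only: dvd_add_left_iff)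
    also have "x * t * (1 - l * t) - (l - t) + p * (x * t * t + 1) = (t + 1) * (t * x - (- 1))"
      by (simp add: True algebra_simps)
    finally show ?thesis
      using pm1_dvd(3)[OF t] admissible_not_pm1(1)[OF l t' not_dvd_units[OF that]]
      by (simp add: cong_iff_dvd)
  qed
  have "pair_count l (p - 1) t = (\<Sum>z\<in>units. \<Sum>x\<in>units. of_bool ((2 - p) * x \<simeq> 1 - t) *
      (of_bool (t * z \<simeq> - 1) * of_bool (\<not> p dvd z * x\<^sup>2 + 1)))"
    unfolding pair_count_def
  proof (intro sum.cong refl)
    fix z x assume "z \<in> units"
    have "x * (1 - (p - 1)) = (2 - p) * x"
      by (simp add: algebra_simps)
    then show "of_bool (admissible l (p - 1) (z * x\<^sup>2)) * of_bool (admissible l t z)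
        * of_bool (x * (1 - (p - 1)) \<simeq> 1 - t) = (of_bool ((2 - p) * x \<simeq> 1 - t) *
      (of_bool (t * z \<simeq> - 1) * of_bool (\<not> p dvd z * x\<^sup>2 + 1)) :: int)"
      unfolding adm[OF \<open>z \<in> units\<close>] admissible_pm1[OF l m disjI2[OF refl]]
      by (simp only: True simp_thms mult_ac)
  qed
  also have "\<dots> = of_bool (\<not> p dvd y * a\<^sup>2 + 1)"
    by (simp only: a(3) y(3))
  also have "p dvd y * a\<^sup>2 + 1 \<longleftrightarrow> p dvd (1 - t)\<^sup>2 - 4 * t"
  proof -
    \<comment> \<open>Modulo p, \<open>A\<close> is 1 - t. The multiple of p with the factor p - 4
      compensates for (2 - p)^2 standing in place of 4.\<close>
    define A where "A = (2 - p) * a"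
    have "p dvd (4 * t) * (y * a\<^sup>2 + 1) \<longleftrightarrow> p dvd (4 * t) * (y * a\<^sup>2 + 1)
      + (p * ((p - 4) * t * y * a\<^sup>2) - A\<^sup>2 * (t * y - (- 1)) + (A + (1 - t)) * (A - (1 - t)))"
      using a(2) y(2) unfolding A_def[symmetric]
      by (simp only: dvd_add_left_iff dvd_add dvd_diff dvd_mult dvd_triv_left)
    also have "(4 * t) * (y * a\<^sup>2 + 1)
      + (p * ((p - 4) * t * y * a\<^sup>2) - A\<^sup>2 * (t * y - (- 1)) + (A + (1 - t)) * (A - (1 - t)))
      = - ((1 - t)\<^sup>2 - 4 * t)"
      by (simp add: A_def power2_eq_square algebra_simps)
    finally have *: "p dvd (4 * t) * (y * a\<^sup>2 + 1) \<longleftrightarrow> p dvd - ((1 - t)\<^sup>2 - 4 * t)" .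
    have "\<not> p dvd 4"
      using p_not_dvd_2 p_dvd_mult_iff[of 2 2] by simp
    then show ?thesis
      using * nd by (simp only: p_dvd_mult_iff dvd_minus_iff simp_thms)
  qed
  finally show ?thesis
    using True by simp
qed

text \<open>The condition for t and the linear condition determine y = (l - t)/(t (1 - l t)) and a =
  (1 - t)/(1 - s). Inserted into the condition for s, with denominators cleared, they give the
  congruence of \<open>triple_condition\<close>. If l = t or l t = 1, both sides are 0.\<close>

lemma pair_count_generic:
  assumes l: "l \<in> units" and s: "s \<in> generic_units" and t: "t \<in> generic_units"
  shows "pair_count l s t = of_bool (triple_condition l s t)"
proof -
  have s': "s \<in> units" "s \<noteq> 1" "s \<noteq> p - 1" and t': "t \<in> units" "t \<noteq> 1" "t \<noteq> p - 1"
    using s t by auto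
  have nd: "\<not> p dvd s" "\<not> p dvd t"
    using s' t' by (simp_all add: not_dvd_units)
  note nd1 = pm1_dvd[OF s] pm1_dvd[OF t]
  note adm_s = admissible_not_pm1[OF l s'] and adm_t = admissible_not_pm1[OF l t']
  show ?thesis
  proof (cases "l = t \<or> l * t \<simeq> 1")
    case True
    have "\<not> admissible l t y" if "y \<in> units" for y
      using True adm_t(2,3)[OF not_dvd_units[OF that]] by blast
    then have "pair_count l s t = 0"
      unfolding pair_count_def by (intro sum.neutral ballI) simp
    moreover have "\<not> triple_condition l s t"
    proof
      assume c: "triple_condition l s t"
      then have "\<not> l * t \<simeq> 1"
        by (simp add: triple_condition_def cong_iff_dvd)
      then have "l = t" using True by blast
      then have "p dvd (s - 1)\<^sup>2 * t * (l - s) * (l * t - 1)"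
        using c by (auto simp: triple_condition_def cong_0_iff)
      then show False
        using c nd by (auto simp: triple_condition_def)
    qed
    ultimately show ?thesis by simp
  next
    case False
    then have lt: "\<not> p dvd l - t" "\<not> p dvd 1 - l * t" "\<not> p dvd l * t - 1"
      using units_cong_iff[OF l t'(1)] by (auto simp: cong_iff_dvd dvd_diff_commute)
    obtain a where a: "a \<in> units" "p dvd (1 - s) * a - (1 - t)"
      "\<And>g. (\<Sum>x\<in>units. of_bool ((1 - s) * x \<simeq> 1 - t) * g x) = (g a :: int)"
      using sum_linear[OF nd1(2) nd1(5)] by blast
    have "\<not> p dvd t * (1 - l * t)" using nd lt by simp
    then obtain y where y: "y \<in> units" "p dvd t * (1 - l * t) * y - (l - t)"
      "\<And>g. (\<Sum>x\<in>units. of_bool (t * (1 - l * t) * x \<simeq> l - t) * g x) = (g y :: int)"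
      using sum_linear[of "t * (1 - l * t)" "l - t"] lt(1) by blast
    have "pair_count l s t = (\<Sum>z\<in>units. \<Sum>x\<in>units. of_bool ((1 - s) * x \<simeq> 1 - t) *
      (of_bool (t * (1 - l * t) * z \<simeq> l - t) * of_bool (admissible l s (z * x\<^sup>2))))"
      unfolding pair_count_def
    proof (intro sum.cong refl)
      fix z x assume "z \<in> units"
      then show "of_bool (admissible l s (z * x\<^sup>2)) * of_bool (admissible l t z)
        * of_bool (x * (1 - s) \<simeq> 1 - t) = (of_bool ((1 - s) * x \<simeq> 1 - t) *
      (of_bool (t * (1 - l * t) * z \<simeq> l - t) * of_bool (admissible l s (z * x\<^sup>2))) :: int)"
        unfolding adm_t(1)[OF not_dvd_units[OF \<open>z \<in> units\<close>]] by (simp add: mult_ac)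
    qed
    also have "\<dots> = of_bool (admissible l s (y * a\<^sup>2))"
      by (simp only: a(3) y(3))
    also have "admissible l s (y * a\<^sup>2) \<longleftrightarrow> triple_condition l s t"
    proof -
      \<comment> \<open>\<open>E\<close> is the difference of the two sides in
        \<open>triple_condition\<close>; modulo p, \<open>A\<close> is 1 - t and \<open>Y\<close> is
        l - t.\<close>
      define E where "E = (s - 1)\<^sup>2 * t * (l - s) * (l * t - 1) - (t - 1)\<^sup>2 * s * (l - t) * (l * s - 1)"
      define A where "A = (1 - s) * a"
      define Y where "Y = t * (1 - l * t) * y"
      have nx: "\<not> p dvd y * a\<^sup>2"
        using not_dvd_units[OF a(1)] not_dvd_units[OF y(1)] by simp
      have "p dvd E \<longleftrightarrow> p dvd E + ((A\<^sup>2 * s * (1 - l * s)) * (Y - (l - t))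
          + ((l - t) * s * (1 - l * s) * (A + (1 - t))) * (A - (1 - t)))"
        using a(2) y(2) unfolding A_def[symmetric] Y_def[symmetric]
        by (simp only: dvd_add_left_iff dvd_add dvd_mult)
      also have "E + ((A\<^sup>2 * s * (1 - l * s)) * (Y - (l - t))
          + ((l - t) * s * (1 - l * s) * (A + (1 - t))) * (A - (1 - t)))
          = (1 - s)\<^sup>2 * t * (1 - l * t) * (y * a\<^sup>2 * s * (1 - l * s) - (l - s))"
        unfolding E_def A_def Y_def by (simp add: power2_eq_square algebra_simps)
      finally have "p dvd E \<longleftrightarrow> p dvd y * a\<^sup>2 * s * (1 - l * s) - (l - s)"
        using nd1 nd lt by (simp only: p_dvd_mult_iff p_dvd_power_iff simp_thms)
      then have E: "p dvd E \<longleftrightarrow> admissible l s (y * a\<^sup>2)"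
        unfolding adm_s(1)[OF nx] cong_iff_dvd .
      have "\<not> p dvd l - s" if "admissible l s (y * a\<^sup>2)"
        using adm_s(2)[OF nx that] units_cong_iff[OF l s'(1)] by (simp add: cong_iff_dvd)
      then show ?thesis
        unfolding triple_condition_def cong_iff_dvd E_def[symmetric] E using nd1 lt by auto
    qed
    finally show ?thesis .
  qed
qed

section \<open>The triple condition at s = 1 and s = -1\<close>

lemma triple_condition_one_left: "\<not> triple_condition l 1 t"
  by (simp add: triple_condition_def)

text \<open>With -1 in place of s, the difference of the two sides has the factors l + 1 and t + 1,
  and the cofactor is linear in l.\<close>

lemma triple_condition_minus_one_left:
  "triple_condition l (p - 1) t \<longleftrightarrow>
    p dvd (l + 1) * (t + 1) * ((3 * t - 1) * l - t * (3 - t)) \<and> \<not> p dvd l + 1 \<and> \<not> p dvd l * t - 1"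
proof -
  have m: "p - 1 \<simeq> - 1"
    by (simp add: cong_iff_dvd)
  have "triple_condition l (p - 1) t \<longleftrightarrow> triple_condition l (- 1) t"
    unfolding triple_condition_def
    by (intro arg_cong2[of _ _ _ _ "(\<and>)"] arg_cong[of _ _ Not] cong_p_eqI cong_dvd_iff
        cong_mult cong_pow cong_diff cong_refl m)
  moreover have "(- 1 - 1)\<^sup>2 * t * (l - (- 1)) * (l * t - 1) - (t - 1)\<^sup>2 * (- 1) * (l - t) * (l * (- 1) - 1)
    = (l + 1) * (t + 1) * ((3 * t - 1) * l - t * (3 - t))"
    by (simp add: power2_eq_square algebra_simps)
  moreover have "p dvd (- 1 - 1)\<^sup>2 * (l - (- 1)) * (l * t - 1) \<longleftrightarrow> p dvd l + 1 \<or> p dvd l * t - 1"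
  proof -
    have "(- 1 - 1)\<^sup>2 * (l - (- 1)) * (l * t - 1) = 2 * (2 * ((l + 1) * (l * t - 1)))"
      by (simp add: power2_eq_square algebra_simps)
    then show ?thesis
      by (simp only: p_dvd_mult_iff p_not_dvd_2 simp_thms)
  qed
  ultimately show ?thesis
    unfolding triple_condition_def cong_iff_dvd by (simp only: de_Morgan_disj)
qed

text \<open>At t = -1 the factor t + 1 makes the congruence hold for every l, and both nonvanishing
  conditions become l \<noteq> -1.\<close>

lemma sum_triple_condition_minus_one:
  "(\<Sum>l\<in>units. of_bool (triple_condition l (p - 1) (p - 1))) = p - 2"
proof -
  have "triple_condition l (p - 1) (p - 1) \<longleftrightarrow> \<not> p dvd l + 1" for l
  proof -
    have "p dvd l * (p - 1) - 1 \<longleftrightarrow> p dvd p * l - (l * (p - 1) - 1)"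
      by (simp only: dvd_diff_right_iff dvd_triv_left)
    then have "p dvd l * (p - 1) - 1 \<longleftrightarrow> p dvd l + 1"
      by (simp add: algebra_simps)
    then show ?thesis
      by (simp add: triple_condition_minus_one_left)
  qed
  then show ?thesis
    by (simp only: sum_not_plus_1_dvd)
qed

text \<open>The only candidate is l = t (3 - t)/(3 t - 1). It is a nonzero residue unless t = 3 or 3
  t = 1, and it is -1 exactly when (1 - t)^2 = 4 t. The form \<open>1 * t \<simeq> 3\<close> matches
  \<open>sum_generic_linear\<close>.\<close>

lemma sum_triple_condition_minus_one_left:
  assumes t: "t \<in> generic_units"
  shows "(\<Sum>l\<in>units. of_bool (triple_condition l (p - 1) t))
    = (of_bool (\<not> p dvd (1 - t)\<^sup>2 - 4 * t) - of_bool (1 * t \<simeq> 3) - of_bool (3 * t \<simeq> 1) :: int)"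
proof -
  have "t \<in> units" using t by simp
  then have nd: "\<not> p dvd t" by (rule not_dvd_units)
  have p8: "\<not> p dvd 8"
    using p_not_dvd_2 p_dvd_power_iff[of 2 3] by simp
  have cond: "triple_condition l (p - 1) t \<longleftrightarrow> \<not> p dvd l + 1 \<and> (3 * t - 1) * l \<simeq> t * (3 - t)" for l
  proof -
    \<comment> \<open>Together with the congruence, l t = 1 would give (t - 1)^3 = 0.\<close>
    have "\<not> p dvd l * t - 1" if "p dvd (3 * t - 1) * l - t * (3 - t)"
    proof
      assume "p dvd l * t - 1"
      then have "p dvd t * ((3 * t - 1) * l - t * (3 - t)) - (3 * t - 1) * (l * t - 1)"
        using that by (simp only: dvd_diff dvd_mult)
      also have "t * ((3 * t - 1) * l - t * (3 - t)) - (3 * t - 1) * (l * t - 1) = (t - 1) ^ 3"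
        by (simp add: power3_eq_cube algebra_simps)
      finally show False
        using pm1_dvd(1)[OF t] by simp
    qed
    then show ?thesis
      unfolding triple_condition_minus_one_left cong_iff_dvd using pm1_dvd(3)[OF t] by auto
  qed
  \<comment> \<open>The exceptional cases t = 3 and 3 t = 1 exclude each other, and in each the
    first indicator is 1, cancelled by exactly one of the other two. All obstructions come down to p
    dividing 8.\<close>
  have D3: "\<not> p dvd (1 - t)\<^sup>2 - 4 * t \<and> \<not> p dvd 3 * t - 1" if "p dvd t - 3"
  proof (intro conjI notI)
    assume "p dvd (1 - t)\<^sup>2 - 4 * t"
    then have "p dvd (t - 3) * (t - 3) - ((1 - t)\<^sup>2 - 4 * t)"
      using that by (simp only: dvd_diff dvd_mult)
    then show False
      using p8 by (simp add: power2_eq_square algebra_simps)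
  next
    assume "p dvd 3 * t - 1"
    then have "p dvd (3 * t - 1) - 3 * (t - 3)"
      using that by (simp only: dvd_diff dvd_mult)
    then show False
      using p8 by simp
  qed
  have D13: "\<not> p dvd (1 - t)\<^sup>2 - 4 * t \<and> \<not> p dvd t * (3 - t)" if "p dvd 3 * t - 1"
  proof (intro conjI notI)
    assume "p dvd (1 - t)\<^sup>2 - 4 * t"
    then have "p dvd (3 * t - 17) * (3 * t - 1) - 9 * ((1 - t)\<^sup>2 - 4 * t)"
      using that by (simp only: dvd_diff dvd_mult)
    then show False
      using p8 by (simp add: power2_eq_square algebra_simps)
  next
    assume "p dvd t * (3 - t)"
    then have "p dvd t - 3"
      using nd by (simp add: dvd_diff_commute)
    with that D3 show False by blast
  qed
  show ?thesis
  proof (cases "p dvd t - 3 \<or> p dvd 3 * t - 1")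
    case True
    have "\<not> (3 * t - 1) * l \<simeq> t * (3 - t)" if "l \<in> units" for l
    proof
      assume l: "(3 * t - 1) * l \<simeq> t * (3 - t)"
      show False
      proof (cases "p dvd 3 * t - 1")
        case True
        then show False
          using l cong_dvd_iff[OF l] D13 by simp
      next
        case False
        then have "p dvd t * (3 - t)"
          using \<open>p dvd t - 3 \<or> p dvd 3 * t - 1\<close> by (simp add: dvd_diff_commute)
        then show False
          using cong_dvd_iff[OF l] False not_dvd_units[OF that] by simp
      qed
    qed
    then have "(\<Sum>l\<in>units. of_bool (triple_condition l (p - 1) t)) = (0 :: int)"
      by (intro sum.neutral ballI) (simp add: cond)
    moreover have "of_bool (\<not> p dvd (1 - t)\<^sup>2 - 4 * t) - of_bool (1 * t \<simeq> 3) - of_bool (3 * t \<simeq> 1) = (0 :: int)"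
      using True
    proof
      assume "p dvd t - 3"
      with D3[OF this] show ?thesis
        by (simp add: cong_iff_dvd)
    next
      assume "p dvd 3 * t - 1"
      moreover from this have "\<not> p dvd t - 3"
        using D3 by blast
      ultimately show ?thesis
        using D13[OF \<open>p dvd 3 * t - 1\<close>] by (simp add: cong_iff_dvd)
    qed
    ultimately show ?thesis by (simp only:)
  next
    case False
    then have nd': "\<not> p dvd 3 * t - 1" "\<not> p dvd t * (3 - t)"
      using nd by (simp_all add: dvd_diff_commute)
    obtain x where x: "x \<in> units" "\<And>l. l \<in> units \<Longrightarrow> (3 * t - 1) * l \<simeq> t * (3 - t) \<longleftrightarrow> l = x"
      using ex1_linear[OF nd'] by blast
    have "(\<Sum>l\<in>units. of_bool (triple_condition l (p - 1) t))
      = (\<Sum>l\<in>units. of_bool ((3 * t - 1) * l \<simeq> t * (3 - t)) * of_bool (\<not> p dvd l + 1) :: int)"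
      by (intro sum.cong refl) (simp add: cond)
    also have "\<dots> = of_bool (\<not> p dvd x + 1)"
      by (intro sum_of_bool_unique) (use x in auto)
    also have "p dvd x + 1 \<longleftrightarrow> p dvd (1 - t)\<^sup>2 - 4 * t"
    proof -
      have "p dvd (3 * t - 1) * x - t * (3 - t)"
        using x by (simp flip: cong_iff_dvd)
      then have "p dvd (3 * t - 1) * (x + 1) \<longleftrightarrow> p dvd (3 * t - 1) * (x + 1) - ((3 * t - 1) * x - t * (3 - t))"
        by (simp only: dvd_diff_left_iff)
      also have "(3 * t - 1) * (x + 1) - ((3 * t - 1) * x - t * (3 - t)) = - ((1 - t)\<^sup>2 - 4 * t)"
        by (simp add: power2_eq_square algebra_simps)
      finally show ?thesis
        using nd' by (simp only: p_dvd_mult_iff dvd_minus_iff simp_thms)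
    qed
    finally show ?thesis
      using False by (simp add: cong_iff_dvd)
  qed
qed

section \<open>Summation over s and t, and comparison with T\<close>

lemma sum_units_symmetric:
  fixes f :: "int \<Rightarrow> int \<Rightarrow> int"
  assumes sym: "\<And>s t. s \<in> units \<Longrightarrow> t \<in> units \<Longrightarrow> f s t = f t s"
    and one: "\<And>t. t \<in> units \<Longrightarrow> t \<noteq> 1 \<Longrightarrow> f 1 t = 0"
  shows "(\<Sum>s\<in>units. \<Sum>t\<in>units. f s t) = f 1 1 + f (p - 1) (p - 1)
    + 2 * (\<Sum>t\<in>generic_units. f (p - 1) t) + (\<Sum>s\<in>generic_units. \<Sum>t\<in>generic_units. f s t)"
proof -
  have u: "1 \<in> units" "p - 1 \<in> units" "p - 1 \<noteq> 1"
    using p_gt_3 by auto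
  have zero: "f 1 (p - 1) = 0" "f (p - 1) 1 = 0" "(\<Sum>t\<in>generic_units. f 1 t) = 0"
    using u one sym[of "p - 1" 1] by (auto intro!: sum.neutral)
  have "(\<Sum>s\<in>generic_units. \<Sum>t\<in>units. f s t)
    = (\<Sum>s\<in>generic_units. f (p - 1) s + (\<Sum>t\<in>generic_units. f s t))"
  proof (rule sum.cong[OF refl])
    fix s assume s: "s \<in> generic_units"
    then have "f s 1 = 0" "f s (p - 1) = f (p - 1) s"
      using sym[of s 1] sym[of s "p - 1"] one[of s] u by auto
    then show "(\<Sum>t\<in>units. f s t) = f (p - 1) s + (\<Sum>t\<in>generic_units. f s t)"
      by (simp add: sum_units_split[of "f s"])
  qed
  then show ?thesis
    unfolding sum_units_split[of "\<lambda>s. \<Sum>t\<in>units. f s t"] sum_units_split[of "f 1"] sum_units_split[of "f (p - 1)"]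
    by (simp add: zero sum.distrib)
qed

text \<open>The last two hypotheses say that the solution d/c is neither 1 nor -1.\<close>

lemma sum_generic_linear:
  assumes "\<not> p dvd c" "\<not> p dvd d" "\<not> p dvd c - d" "\<not> p dvd c + d"
  shows "(\<Sum>t\<in>generic_units. of_bool (c * t \<simeq> d)) = (1 :: int)"
proof -
  obtain x where x: "x \<in> units" "\<And>t. t \<in> units \<Longrightarrow> c * t \<simeq> d \<longleftrightarrow> t = x"
    using ex1_linear[OF assms(1,2)] by blast
  have "p dvd c * (p - 1) - d \<longleftrightarrow> p dvd p * c - (c * (p - 1) - d)"
    by (simp only: dvd_diff_right_iff dvd_triv_left)
  also have "p * c - (c * (p - 1) - d) = c + d"
    by (simp add: algebra_simps)
  finally have "\<not> c * (p - 1) \<simeq> d"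
    using assms by (simp add: cong_iff_dvd)
  moreover have "\<not> c * 1 \<simeq> d"
    using assms by (simp add: cong_iff_dvd)
  ultimately have "x \<in> generic_units"
    using x(1) x(2)[of x] by auto
  then have "(\<Sum>t\<in>generic_units. of_bool (c * t \<simeq> d) * 1) = (1 :: int)"
    using x(2) by (intro sum_of_bool_unique[where x = x]) auto
  then show ?thesis by (simp only: mult_1_right)
qed

text \<open>Both sums are split in the same way. The generic part \<open>G\<close>, the number
  \<open>D\<close> and the p - 2 from s = t = -1 occur on both sides and cancel, so \<open>D\<close>
  is never evaluated. What remains is (p - 2)^2 + 1 from s = t = 1, and 4 from t = 3 and 3 t = 1,
  each counted twice by symmetry.\<close>

lemma sum_pair_count:
  "(\<Sum>l\<in>units. \<Sum>s\<in>units. \<Sum>t\<in>units. pair_count l s t)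
    = p\<^sup>2 - 4 * p + 9 + (\<Sum>l\<in>units. \<Sum>s\<in>units. \<Sum>t\<in>units. of_bool (triple_condition l s t))"
proof -
  define G :: "int \<Rightarrow> int" where
    "G l = (\<Sum>s\<in>generic_units. \<Sum>t\<in>generic_units. of_bool (triple_condition l s t))" for l
  define D :: int where "D = (\<Sum>t\<in>generic_units. of_bool (\<not> p dvd (1 - t)\<^sup>2 - 4 * t))"
  have u: "1 \<in> units" "p - 1 \<in> units"
    using p_gt_3 by auto
  have delta: "(\<Sum>l\<in>units. of_bool (l = x) * c) = (c :: int)" if "x \<in> units" for x c
    by (rule sum_of_bool_unique) (use that in auto)
  have "(\<Sum>l\<in>units. \<Sum>s\<in>units. \<Sum>t\<in>units. pair_count l s t)
    = (\<Sum>l\<in>units. of_bool (l = 1) * ((p - 2)\<^sup>2 + 1) + of_bool (l = p - 1) * (p - 2)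
        + 2 * (of_bool (l = p - 1) * D) + G l)"
  proof (rule sum.cong[OF refl])
    fix l assume l: "l \<in> units"
    have "(\<Sum>s\<in>units. \<Sum>t\<in>units. pair_count l s t) = pair_count l 1 1 + pair_count l (p - 1) (p - 1)
      + 2 * (\<Sum>t\<in>generic_units. pair_count l (p - 1) t)
      + (\<Sum>s\<in>generic_units. \<Sum>t\<in>generic_units. pair_count l s t)"
      by (intro sum_units_symmetric pair_count_commute pair_count_one_left)
    also have "(\<Sum>t\<in>generic_units. pair_count l (p - 1) t) = of_bool (l = p - 1) * D"
      unfolding D_def sum_distrib_left by (intro sum.cong refl pair_count_minus_one_left l)
    also have "(\<Sum>s\<in>generic_units. \<Sum>t\<in>generic_units. pair_count l s t) = G l"
      unfolding G_def by (intro sum.cong refl pair_count_generic l)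
    finally show "(\<Sum>s\<in>units. \<Sum>t\<in>units. pair_count l s t)
      = of_bool (l = 1) * ((p - 2)\<^sup>2 + 1) + of_bool (l = p - 1) * (p - 2)
        + 2 * (of_bool (l = p - 1) * D) + G l"
      by (simp only: pair_count_one[OF l] pair_count_minus_one[OF l])
  qed
  also have "\<dots> = (p - 2)\<^sup>2 + 1 + (p - 2) + 2 * D + (\<Sum>l\<in>units. G l)"
    by (simp only: sum.distrib delta u sum_distrib_left[symmetric])
  finally have A: "(\<Sum>l\<in>units. \<Sum>s\<in>units. \<Sum>t\<in>units. pair_count l s t)
    = (p - 2)\<^sup>2 + 1 + (p - 2) + 2 * D + (\<Sum>l\<in>units. G l)" .
  have "(\<Sum>l\<in>units. \<Sum>s\<in>units. \<Sum>t\<in>units. of_bool (triple_condition l s t))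
    = (\<Sum>l\<in>units. of_bool (triple_condition l (p - 1) (p - 1))
        + 2 * (\<Sum>t\<in>generic_units. of_bool (triple_condition l (p - 1) t)) + G l)"
  proof (rule sum.cong[OF refl])
    fix l
    show "(\<Sum>s\<in>units. \<Sum>t\<in>units. of_bool (triple_condition l s t))
      = of_bool (triple_condition l (p - 1) (p - 1))
        + 2 * (\<Sum>t\<in>generic_units. of_bool (triple_condition l (p - 1) t)) + G l"
      unfolding G_def
      by (subst sum_units_symmetric)
        (simp_all only: triple_condition_commute triple_condition_one_left of_bool_eq add_0)
  qed
  also have "\<dots> = (p - 2) + 2 * (\<Sum>l\<in>units. \<Sum>t\<in>generic_units. of_bool (triple_condition l (p - 1) t))
      + (\<Sum>l\<in>units. G l)"
    by (simp only: sum.distrib sum_distrib_left[symmetric] sum_triple_condition_minus_one)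
  also have "(\<Sum>l\<in>units. \<Sum>t\<in>generic_units. of_bool (triple_condition l (p - 1) t))
    = (\<Sum>t\<in>generic_units. \<Sum>l\<in>units. of_bool (triple_condition l (p - 1) t) :: int)"
    by (rule sum.swap)
  also have "\<dots> = (\<Sum>t\<in>generic_units. of_bool (\<not> p dvd (1 - t)\<^sup>2 - 4 * t)
      - of_bool (1 * t \<simeq> 3) - of_bool (3 * t \<simeq> 1))"
    by (intro sum.cong refl sum_triple_condition_minus_one_left)
  also have "\<dots> = D - 1 - 1"
  proof -
    have "\<not> p dvd 4"
      using p_not_dvd_2 p_dvd_mult_iff[of 2 2] by simp
    then show ?thesis
      unfolding D_def sum_subtractf by (subst (1 2) sum_generic_linear) simp_all
  qed
  finally show ?thesis
    unfolding A by (simp add: power2_eq_square algebra_simps)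
qed

text \<open>Multiplication by a b clears the inverses in the congruence; in the argument of the
  principal character, the factor with u/a - 1 vanishes exactly when u = a.\<close>

lemma T_eq: "T p = of_int (\<Sum>l\<in>units. \<Sum>s\<in>units. \<Sum>t\<in>units. of_bool (triple_condition l s t))"
proof -
  define P where "P u a b \<longleftrightarrow> [(a - 1)\<^sup>2 * (u * modular_inverse p a - 1) * (u * b - 1) =
         (b - 1)\<^sup>2 * (u * modular_inverse p b - 1) * (u * a - 1)] (mod p)" for u a b
  define Q where "Q u a b = (a - 1)\<^sup>2 * (u * modular_inverse p a - 1) * (u * b - 1)" for u a b
  have "T p = (\<Sum>(u, a, b) \<in> units \<times> units \<times> units. if P u a b then principal_character p (Q u a b) else 0)"
    unfolding T_def P_def Q_def
    by (rule sum.mono_neutral_cong_left) (auto split: if_split_asm)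
  also have "\<dots> = (\<Sum>u\<in>units. \<Sum>a\<in>units. \<Sum>b\<in>units. if P u a b then principal_character p (Q u a b) else 0)"
    by (simp add: sum.cartesian_product)
  also have "\<dots> = (\<Sum>u\<in>units. \<Sum>a\<in>units. \<Sum>b\<in>units. of_int (of_bool (triple_condition u a b)))"
  proof (intro sum.cong refl)
    fix u a b assume ab: "a \<in> units" "b \<in> units"
    define i j where "i = modular_inverse p a" and "j = modular_inverse p b"
    have i: "p dvd a * i - 1" and j: "p dvd b * j - 1"
      unfolding i_def j_def by (rule inverse_dvd, rule ab)+
    have nd: "\<not> p dvd a" "\<not> p dvd b"
      using ab by (simp_all add: not_dvd_units)
    have 1: "p dvd u * i - 1 \<longleftrightarrow> p dvd u - a"
    proof -
      have "p dvd a * (u * i - 1) \<longleftrightarrow> p dvd a * (u * i - 1) - u * (a * i - 1)"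
        using i by (simp only: dvd_diff_left_iff dvd_mult)
      also have "a * (u * i - 1) - u * (a * i - 1) = u - a"
        by (simp add: algebra_simps)
      finally show ?thesis
        using nd by (simp only: p_dvd_mult_iff simp_thms)
    qed
    define X where "X = (a - 1)\<^sup>2 * (u * i - 1) * (u * b - 1) - (b - 1)\<^sup>2 * (u * j - 1) * (u * a - 1)"
    have "p dvd (a * b) * X \<longleftrightarrow> p dvd (a * b) * X
        - ((a - 1)\<^sup>2 * (u * b - 1) * b * u * (a * i - 1) - (b - 1)\<^sup>2 * (u * a - 1) * a * u * (b * j - 1))"
      using i j by (simp only: dvd_diff_left_iff dvd_diff dvd_mult)
    also have "(a * b) * X
        - ((a - 1)\<^sup>2 * (u * b - 1) * b * u * (a * i - 1) - (b - 1)\<^sup>2 * (u * a - 1) * a * u * (b * j - 1))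
      = (a - 1)\<^sup>2 * b * (u - a) * (u * b - 1) - (b - 1)\<^sup>2 * a * (u - b) * (u * a - 1)"
      unfolding X_def by (simp add: algebra_simps)
    finally have "P u a b \<longleftrightarrow> (a - 1)\<^sup>2 * b * (u - a) * (u * b - 1) \<simeq> (b - 1)\<^sup>2 * a * (u - b) * (u * a - 1)"
      using nd unfolding P_def i_def[symmetric] j_def[symmetric] cong_iff_dvd X_def[symmetric]
      by (simp only: p_dvd_mult_iff simp_thms)
    then show "(if P u a b then principal_character p (Q u a b) else 0)
      = of_int (of_bool (triple_condition u a b))"
      unfolding triple_condition_def principal_character_def coprime_p_iff Q_def i_def[symmetric]
      by (simp add: 1)
  qed
  finally show ?thesis
    by (simp only: of_int_sum)
qed

end

section \<open>Assembly of the moment formula\<close>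

theorem theorem1p2:
  fixes p n k :: int
  assumes "prime p" and "p > 3" and "coprime n p" and "coprime k p"
  shows "complex_of_real
      (\<Sum>\<chi> \<in> dirichlet_characters p. \<Sum>m = 1..p - 1.
        (cmod (\<Sum>a = 1..p - 1. \<chi> (m * a + n * modular_inverse p a) *
                 unit_exp (of_int (k * a) / of_int p))) ^ 4) =
    (of_int p - 1) * ((of_int p)\<^sup>2 - 10 * of_int p + 37 + of_int p * T p - of_int (T_L p))"
proof -
  interpret prime_gt_3 p
    using assms by unfold_locales
  have n: "\<not> p dvd n" and k: "\<not> p dvd k"
    using assms by (simp_all add: coprime_p_iff)
  define S where "S \<chi> m = cmod (\<Sum>a\<in>units. \<chi> (m * a + modular_inverse p a) * additive_char k a)" for \<chi> m
  define \<tau> :: int where "\<tau> = (\<Sum>l\<in>units. \<Sum>s\<in>units. \<Sum>t\<in>units. of_bool (triple_condition l s t))"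
  have "(\<Sum>\<chi> \<in> dirichlet_characters p. \<Sum>m = 1..p - 1.
        (cmod (\<Sum>a = 1..p - 1. \<chi> (m * a + n * modular_inverse p a) *
                 unit_exp (of_int (k * a) / of_int p))) ^ 4)
    = (\<Sum>\<chi> \<in> dirichlet_characters p. \<Sum>m\<in>units. S \<chi> m ^ 4)"
  proof (rule sum.cong[OF refl])
    fix \<chi> assume \<chi>: "\<chi> \<in> dirichlet_characters p"
    define F where "F m = (cmod (\<Sum>a\<in>units. \<chi> (m * a + n * modular_inverse p a) * additive_char k a)) ^ 4" for m
    have F_cong: "F m = F m'" if "m \<simeq> m'" for m m'
      unfolding F_def using that
      by (intro arg_cong2[of _ _ _ _ "(^)"] arg_cong[of _ _ cmod] sum.cong refl
          arg_cong2[of _ _ _ _ "(*)"] periodic_cong[OF character_periodic[OF \<chi>]] cong_add cong_mult cong_refl)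
    \<comment> \<open>Replacing m by n m lets \<chi>(n), of modulus 1, be taken out of the inner
      sum.\<close>
    have "(\<Sum>m\<in>units. F m) = (\<Sum>m\<in>units. F (n * m))"
      by (intro sum_units_scale[symmetric] n periodicI F_cong cong_mod_p)
    also have "\<dots> = (\<Sum>m\<in>units. S \<chi> m ^ 4)"
    proof (rule sum.cong[OF refl])
      fix m
      have "(\<Sum>a\<in>units. \<chi> (n * m * a + n * modular_inverse p a) * additive_char k a)
        = \<chi> n * (\<Sum>a\<in>units. \<chi> (m * a + modular_inverse p a) * additive_char k a)"
        unfolding sum_distrib_left
        by (intro sum.cong refl) (simp add: mult.assoc flip: distrib_left character_mult[OF \<chi>])
      then show "F (n * m) = S \<chi> m ^ 4"
        using norm_character[OF \<chi> n] by (simp add: F_def S_def norm_mult)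
    qed
    finally show "(\<Sum>m = 1..p - 1. (cmod (\<Sum>a = 1..p - 1. \<chi> (m * a + n * modular_inverse p a) *
                 unit_exp (of_int (k * a) / of_int p))) ^ 4) = (\<Sum>m\<in>units. S \<chi> m ^ 4)"
      by (simp only: F_def additive_char_def)
  qed
  also have "\<dots> = (\<Sum>m\<in>units. \<Sum>\<chi> \<in> dirichlet_characters p. S \<chi> m ^ 4)"
    by (rule sum.swap)
  also have "\<dots> = of_int (p - 1) * (\<Sum>m\<in>units. \<Sum>l\<in>units. (cmod
        (\<Sum>a\<in>units. \<Sum>s\<in>units. of_bool (admissible l s (m * a\<^sup>2)) * additive_char k (a * (1 - s))))\<^sup>2)"
    unfolding S_def sum_fourth_power sum_distrib_left ..
  finally have "complex_of_real (\<Sum>\<chi> \<in> dirichlet_characters p. \<Sum>m = 1..p - 1.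
        (cmod (\<Sum>a = 1..p - 1. \<chi> (m * a + n * modular_inverse p a) *
                 unit_exp (of_int (k * a) / of_int p))) ^ 4)
    = of_int (p - 1) * complex_of_real (\<Sum>m\<in>units. \<Sum>l\<in>units. (cmod
        (\<Sum>a\<in>units. \<Sum>s\<in>units. of_bool (admissible l s (m * a\<^sup>2)) * additive_char k (a * (1 - s))))\<^sup>2)"
    by (simp only: of_real_mult of_real_of_int_eq)
  \<comment> \<open>The factor p - 1 from Parseval is the one consumed by the averaging in
    \<open>sum_norm_square\<close>; the p - 1 of the final formula comes from the two counts, which
    both carry it.\<close>
  also have "\<dots> = of_int (p * ((p - 1) * (p\<^sup>2 - 4 * p + 9 + \<tau>))
      - (p - 1) * (p ^ 3 - 5 * p\<^sup>2 + 19 * p - 37 + T_L p))"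
    unfolding sum_norm_square[OF k] sum_eq_pair_count sum_admissible_square \<tau>_def
    by (simp only: sum_pair_count flip: sum_distrib_left)
  also have "p * ((p - 1) * (p\<^sup>2 - 4 * p + 9 + \<tau>)) - (p - 1) * (p ^ 3 - 5 * p\<^sup>2 + 19 * p - 37 + T_L p)
    = (p - 1) * (p\<^sup>2 - 10 * p + 37 + p * \<tau> - T_L p)"
    by (simp add: power2_eq_square power3_eq_cube algebra_simps)
  finally show ?thesis
    unfolding T_eq \<tau>_def[symmetric] by simp
qed

end
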